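(* Let $q$ be a prime power and let $SE_6(q)$ be the group of $\mathbb{F}_q$-linear maps of the $27$-dimensional space $\mathbb{J}=\mathbb{J}_{\mathbb{F}_q}$ which preserve the cubic form $\det$ (the Dickson--Freudenthal determinant). Then $$|SE_6(q)| = q^{36}(q^{12}-1)(q^9-1)(q^8-1)(q^6-1)(q^5-1)(q^2-1).$$
   Context: Split octonions. For a field $F$, the split octonion algebra $\mathbb{O}=\mathbb{O}_F$ is the $8$-dimensional $F$-vector space with basis $\{e_i : i\in\pm I\}$, where $I=\{0,1,\omega,\bar\omega\}$ and $\pm I=\{\pm0,\pm1,\pm\omega,\pm\bar\omega\}$ ($8$ distinct labels, $0$ and $-0$ being different), with bilinear multiplication given by (1) $e_1e_\omega=-e_\omega e_1=e_{-\bar\omega}$; (2) $e_1e_0=e_{-0}e_1=e_1$; (3) $e_{-1}e_1=-e_0$ and $e_0e_0=e_0$; together with all the images of these rules under negating all subscripts (including $0\leftrightarrow -0$) and under multiplying all subscripts by $\omega$ (that is $1\mapsto\omega\mapsto\bar\omega\mapsto1$, $-1\mapsto-\omega\mapsto-\bar\omega\mapsto-1$, fixing $0$ and $-0$). All other products of basis vectors are $0$. The identity is $1=e_0+e_{-0}$, and $F$ is identified with $F\cdot 1$. The conjugation $x\mapsto\overline{x}$ is the linear map $e_0\leftrightarrow e_{-0}$, $e_i\mapsto -e_i$ for $i\ne\pm0$; it is an anti-automorphism. The trace is $\mathrm{Tr}(\sum\lambda_ie_i)=\lambda_0+\lambda_{-0}$, so $\mathrm{Tr}(x)=x+\overline{x}$,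 and $x\overline{x}=\sum_{i\in I}\lambda_i\lambda_{-i}\in F$ for $x=\sum\lambda_ie_i$. One has $\mathrm{Tr}(x(yz))=\mathrm{Tr}((xy)z)$, written $\mathrm{Tr}(xyz)$. The space $\mathbb{J}=\mathbb{J}_F$ is the $27$-dimensional $F$-space of Hermitian matrices $(a,b,c\mid A,B,C)=\begin{pmatrix}a&C&\overline{B}\\ \overline{C}&b&A\\ B&\overline{A}&c\end{pmatrix}$ with $a,b,c\in F$ and $A,B,C\in\mathbb{O}_F$. The Dickson--Freudenthal determinant is the cubic form (homogeneous polynomial of degree $3$ in the $27$ coordinates) $\det(a,b,c\mid A,B,C)=abc-aA\overline{A}-bB\overline{B}-cC\overline{C}+\mathrm{Tr}(ABC)$. A linear map preserves $\det$ if it preserves it as a cubic form (polynomial). *)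

theory Defs
  imports
    "HOL-Analysis.Analysis"
    "HOL-Library.Poly_Mapping"
    "HOL-Number_Theory.Prime_Powers"
    "HOL-Algebra.Coset"
begin

section \<open>Split octonions\<close>

text \<open>
  The set \<open>I = {0, 1, \<omega>, \<omega>\<^sup>2}\<close> (the last element is the conjugate of \<open>\<omega>\<close>) and
  the eight distinct labels \<open>\<plusminus>I\<close>; note that \<open>Pos I0\<close> and \<open>Neg I0\<close> are different.
\<close>

datatype idx = I0 | I1 | I\<omega> | I\<omega>bar

datatype pmidx = Pos idx | Neg idx

lemma UNIV_idx: "(UNIV :: idx set) = {I0, I1, I\<omega>, I\<omega>bar}"
proof (intro Set.set_eqI iffI)
  fix i :: idx
  show "i \<in> {I0, I1, I\<omega>, I\<omega>bar}" by (cases i) simp_all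
qed simp

lemma UNIV_pmidx:
  "(UNIV :: pmidx set) =
     {Pos I0, Pos I1, Pos I\<omega>, Pos I\<omega>bar, Neg I0, Neg I1, Neg I\<omega>, Neg I\<omega>bar}"
proof (intro Set.set_eqI iffI)
  fix i :: pmidx
  show "i \<in> {Pos I0, Pos I1, Pos I\<omega>, Pos I\<omega>bar, Neg I0, Neg I1, Neg I\<omega>, Neg I\<omega>bar}"
  proof (cases i)
    case (Pos j) then show ?thesis by (cases j) simp_all
  next
    case (Neg j) then show ?thesis by (cases j) simp_all
  qed
qed simp

instance idx :: finite
  by standard (simp add: UNIV_idx)

instance pmidx :: finite
  by standard (simp add: UNIV_pmidx)

fun neg_idx :: "pmidx \<Rightarrow> pmidx" where
  "neg_idx (Pos i) = Neg i"
| "neg_idx (Neg i) = Pos i"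

fun rot0_idx :: "idx \<Rightarrow> idx" where
  "rot0_idx I0 = I0"
| "rot0_idx I1 = I\<omega>"
| "rot0_idx I\<omega> = I\<omega>bar"
| "rot0_idx I\<omega>bar = I1"

fun rot_idx :: "pmidx \<Rightarrow> pmidx" where
  "rot_idx (Pos i) = Pos (rot0_idx i)"
| "rot_idx (Neg i) = Neg (rot0_idx i)"

text \<open>
  \<open>basis_product i j s k\<close> says that the multiplication rules contain \<open>e\<^sub>i e\<^sub>j = s e\<^sub>k\<close>,
  where the sign \<open>s\<close> is \<open>1\<close> or \<open>- 1\<close>.  The last two clauses close the listed rules under
  negating all subscripts and under multiplying all subscripts by \<open>\<omega>\<close>.
\<close>

inductive basis_product :: "pmidx \<Rightarrow> pmidx \<Rightarrow> int \<Rightarrow> pmidx \<Rightarrow> bool" where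
  one_omega: "basis_product (Pos I1) (Pos I\<omega>) 1 (Neg I\<omega>bar)"
| omega_one: "basis_product (Pos I\<omega>) (Pos I1) (- 1) (Neg I\<omega>bar)"
| one_zero: "basis_product (Pos I1) (Pos I0) 1 (Pos I1)"
| negzero_one: "basis_product (Neg I0) (Pos I1) 1 (Pos I1)"
| negone_one: "basis_product (Neg I1) (Pos I1) (- 1) (Pos I0)"
| zero_zero: "basis_product (Pos I0) (Pos I0) 1 (Pos I0)"
| negate: "basis_product i j s k \<Longrightarrow> basis_product (neg_idx i) (neg_idx j) s (neg_idx k)"
| rotate: "basis_product i j s k \<Longrightarrow> basis_product (rot_idx i) (rot_idx j) s (rot_idx k)"

text \<open>
  The coefficient of \<open>e\<^sub>k\<close> in \<open>e\<^sub>i e\<^sub>j\<close>; it is \<open>0\<close> if no rule applies.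
\<close>

definition structure_const :: "pmidx \<Rightarrow> pmidx \<Rightarrow> pmidx \<Rightarrow> int" where
  "structure_const i j k =
     (if basis_product i j 1 k then 1 else if basis_product i j (- 1) k then - 1 else 0)"

text \<open>
  Everything up to the determinant is defined over an arbitrary commutative ring, because the
  determinant will also be evaluated at the generic point, whose coordinates are indeterminates.
\<close>

type_synonym 'a oct = "'a ^ pmidx"

definition oct_mult :: "'a::comm_ring_1 oct \<Rightarrow> 'a oct \<Rightarrow> 'a oct" (infixl "\<odot>" 70) where
  "x \<odot> y = (\<chi> k. \<Sum>i\<in>UNIV. \<Sum>j\<in>UNIV. of_int (structure_const i j k) * (x $ i * y $ j))"

definition oct_one :: "'a::comm_ring_1 oct" where
  "oct_one = axis (Pos I0) 1 + axis (Neg I0) 1"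

definition oct_cnj :: "'a::comm_ring_1 oct \<Rightarrow> 'a oct" where
  "oct_cnj x = (\<chi> i. if i \<in> {Pos I0, Neg I0} then x $ neg_idx i else - (x $ i))"

definition oct_trace :: "'a::comm_ring_1 oct \<Rightarrow> 'a" where
  "oct_trace x = x $ Pos I0 + x $ Neg I0"

text \<open>
  The scalar \<open>x \<odot> oct_cnj x\<close>, as an element of the base ring; see \<open>oct_mult_cnj\<close> below.
\<close>

definition oct_norm :: "'a::comm_ring_1 oct \<Rightarrow> 'a" where
  "oct_norm x = (\<Sum>i\<in>UNIV. x $ Pos i * x $ Neg i)"

subsection \<open>The multiplication table and its basic consequences\<close>

definition basis_table :: "(pmidx \<times> pmidx \<times> int \<times> pmidx) set" where
  "basis_table =
    {(Pos I1, Pos I\<omega>, 1, Neg I\<omega>bar), (Pos I\<omega>, Pos I1, - 1, Neg I\<omega>bar),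
     (Pos I\<omega>, Pos I\<omega>bar, 1, Neg I1), (Pos I\<omega>bar, Pos I\<omega>, - 1, Neg I1),
     (Pos I\<omega>bar, Pos I1, 1, Neg I\<omega>), (Pos I1, Pos I\<omega>bar, - 1, Neg I\<omega>),
     (Neg I1, Neg I\<omega>, 1, Pos I\<omega>bar), (Neg I\<omega>, Neg I1, - 1, Pos I\<omega>bar),
     (Neg I\<omega>, Neg I\<omega>bar, 1, Pos I1), (Neg I\<omega>bar, Neg I\<omega>, - 1, Pos I1),
     (Neg I\<omega>bar, Neg I1, 1, Pos I\<omega>), (Neg I1, Neg I\<omega>bar, - 1, Pos I\<omega>),
     (Pos I1, Pos I0, 1, Pos I1), (Neg I0, Pos I1, 1, Pos I1),
     (Pos I\<omega>, Pos I0, 1, Pos I\<omega>), (Neg I0, Pos I\<omega>, 1, Pos I\<omega>),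
     (Pos I\<omega>bar, Pos I0, 1, Pos I\<omega>bar), (Neg I0, Pos I\<omega>bar, 1, Pos I\<omega>bar),
     (Neg I1, Neg I0, 1, Neg I1), (Pos I0, Neg I1, 1, Neg I1),
     (Neg I\<omega>, Neg I0, 1, Neg I\<omega>), (Pos I0, Neg I\<omega>, 1, Neg I\<omega>),
     (Neg I\<omega>bar, Neg I0, 1, Neg I\<omega>bar), (Pos I0, Neg I\<omega>bar, 1, Neg I\<omega>bar),
     (Neg I1, Pos I1, - 1, Pos I0), (Pos I1, Neg I1, - 1, Neg I0),
     (Neg I\<omega>, Pos I\<omega>, - 1, Pos I0), (Pos I\<omega>, Neg I\<omega>, - 1, Neg I0),
     (Neg I\<omega>bar, Pos I\<omega>bar, - 1, Pos I0), (Pos I\<omega>bar, Neg I\<omega>bar, - 1, Neg I0),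
     (Pos I0, Pos I0, 1, Pos I0), (Neg I0, Neg I0, 1, Neg I0)}"

lemma basis_product_iff: "basis_product i j s k \<longleftrightarrow> (i, j, s, k) \<in> basis_table"
proof
  have "\<forall>(i, j, s, k) \<in> basis_table. (neg_idx i, neg_idx j, s, neg_idx k) \<in> basis_table"
    and "\<forall>(i, j, s, k) \<in> basis_table. (rot_idx i, rot_idx j, s, rot_idx k) \<in> basis_table"
    by (simp_all add: basis_table_def)
  then have closed:
    "(i, j, s, k) \<in> basis_table \<Longrightarrow> (neg_idx i, neg_idx j, s, neg_idx k) \<in> basis_table"
    "(i, j, s, k) \<in> basis_table \<Longrightarrow> (rot_idx i, rot_idx j, s, rot_idx k) \<in> basis_table"
    for i j s k
    by blast+
  assume "basis_product i j s k"
  then show "(i, j, s, k) \<in> basis_table"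
  proof induction
    case (negate i j s k)
    then show ?case by (intro closed)
  next
    case (rotate i j s k)
    then show ?case by (intro closed)
  qed (simp_all add: basis_table_def)
next
  note p = one_omega omega_one one_zero negzero_one negone_one zero_zero
  note n = p[THEN negate, simplified]
  note r = p[THEN rotate, simplified] n[THEN rotate, simplified]
  note rr = r[THEN rotate, simplified]
  have "\<forall>(i, j, s, k) \<in> basis_table. basis_product i j s k"
    by (simp add: basis_table_def p n r rr)
  moreover assume "(i, j, s, k) \<in> basis_table"
  ultimately show "basis_product i j s k"
    by blast
qed

lemma structure_const_eq:
  "structure_const i j k =
     (if (i, j, 1, k) \<in> basis_table then 1 else if (i, j, - 1, k) \<in> basis_table then - 1 else 0)"
  by (simp add: structure_const_def basis_product_iff)

lemma oct_mult_nth: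
  fixes x y :: "'a::comm_ring_1 oct"
  shows
    "(x \<odot> y) $ Pos I0 = x $ Pos I0 * y $ Pos I0
       - x $ Neg I1 * y $ Pos I1 - x $ Neg I\<omega> * y $ Pos I\<omega> - x $ Neg I\<omega>bar * y $ Pos I\<omega>bar"
    "(x \<odot> y) $ Neg I0 = x $ Neg I0 * y $ Neg I0
       - x $ Pos I1 * y $ Neg I1 - x $ Pos I\<omega> * y $ Neg I\<omega> - x $ Pos I\<omega>bar * y $ Neg I\<omega>bar"
    "(x \<odot> y) $ Pos I1 = x $ Pos I1 * y $ Pos I0 + x $ Neg I0 * y $ Pos I1
       + x $ Neg I\<omega> * y $ Neg I\<omega>bar - x $ Neg I\<omega>bar * y $ Neg I\<omega>"
    "(x \<odot> y) $ Pos I\<omega> = x $ Pos I\<omega> * y $ Pos I0 + x $ Neg I0 * y $ Pos I\<omega>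
       + x $ Neg I\<omega>bar * y $ Neg I1 - x $ Neg I1 * y $ Neg I\<omega>bar"
    "(x \<odot> y) $ Pos I\<omega>bar = x $ Pos I\<omega>bar * y $ Pos I0 + x $ Neg I0 * y $ Pos I\<omega>bar
       + x $ Neg I1 * y $ Neg I\<omega> - x $ Neg I\<omega> * y $ Neg I1"
    "(x \<odot> y) $ Neg I1 = x $ Neg I1 * y $ Neg I0 + x $ Pos I0 * y $ Neg I1
       + x $ Pos I\<omega> * y $ Pos I\<omega>bar - x $ Pos I\<omega>bar * y $ Pos I\<omega>"
    "(x \<odot> y) $ Neg I\<omega> = x $ Neg I\<omega> * y $ Neg I0 + x $ Pos I0 * y $ Neg I\<omega>
       + x $ Pos I\<omega>bar * y $ Pos I1 - x $ Pos I1 * y $ Pos I\<omega>bar"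
    "(x \<odot> y) $ Neg I\<omega>bar = x $ Neg I\<omega>bar * y $ Neg I0 + x $ Pos I0 * y $ Neg I\<omega>bar
       + x $ Pos I1 * y $ Pos I\<omega> - x $ Pos I\<omega> * y $ Pos I1"
  by (simp_all add: oct_mult_def structure_const_eq basis_table_def UNIV_pmidx)

lemma all_pmidx: "(\<forall>i. P i) \<longleftrightarrow>
    P (Pos I0) \<and> P (Pos I1) \<and> P (Pos I\<omega>) \<and> P (Pos I\<omega>bar) \<and>
    P (Neg I0) \<and> P (Neg I1) \<and> P (Neg I\<omega>) \<and> P (Neg I\<omega>bar)"
  using UNIV_pmidx by (metis UNIV_I empty_iff insert_iff)

lemmas oct_eval = oct_mult_nth oct_one_def oct_cnj_def oct_trace_def oct_norm_def
  UNIV_idx axis_def vec_eq_iff all_pmidx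

lemma oct_mult_one: "x \<odot> oct_one = x" "oct_one \<odot> x = x"
  by (simp_all add: oct_eval)

lemma oct_mult_cnj: "x \<odot> oct_cnj x = oct_norm x *s oct_one"
  by (simp add: oct_eval algebra_simps)

lemma oct_cnj_mult: "oct_cnj (x \<odot> y) = oct_cnj y \<odot> oct_cnj x"
  by (simp add: oct_eval algebra_simps)

lemma oct_trace_assoc: "oct_trace (x \<odot> (y \<odot> z)) = oct_trace ((x \<odot> y) \<odot> z)"
  by (simp add: oct_eval algebra_simps)

section \<open>Hermitian matrices and the Dickson--Freudenthal determinant\<close>

text \<open>
  The \<open>27\<close> coordinates of the Hermitian matrix with diagonal \<open>a, b, c\<close>, entries \<open>A, B, C\<close> in the
  positions \<open>(2,3)\<close>, \<open>(3,1)\<close>, \<open>(1,2)\<close>, and their conjugates in the transposed positions.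
  The space of these matrices is represented by its coordinate space.
\<close>

datatype jidx = Ja | Jb | Jc | JA pmidx | JB pmidx | JC pmidx

lemma UNIV_jidx:
  "(UNIV :: jidx set) = {Ja, Jb, Jc} \<union> range JA \<union> range JB \<union> range JC"
proof (intro Set.set_eqI iffI)
  fix i :: jidx
  show "i \<in> {Ja, Jb, Jc} \<union> range JA \<union> range JB \<union> range JC" by (cases i) simp_all
qed simp

instance jidx :: finite
  by standard (simp add: UNIV_jidx)

type_synonym 'a herm = "'a ^ jidx"

definition dickson_freudenthal_det :: "'a::comm_ring_1 herm \<Rightarrow> 'a" where
  "dickson_freudenthal_det x =
     (let a = x $ Ja; b = x $ Jb; c = x $ Jc;
          A = (\<chi> i. x $ JA i); B = (\<chi> i. x $ JB i); C = (\<chi> i. x $ JC i)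
      in a * b * c - a * oct_norm A - b * oct_norm B - c * oct_norm C
           + oct_trace (A \<odot> (B \<odot> C)))"

section \<open>Preservation of the cubic form as a polynomial\<close>

text \<open>
  Polynomials over \<open>'a\<close> in indeterminates indexed by the \<open>27\<close> coordinates: finitely supported
  functions from monomials (exponent vectors) to coefficients, with the convolution product.
\<close>

type_synonym 'a jpoly = "(jidx \<Rightarrow>\<^sub>0 nat) \<Rightarrow>\<^sub>0 'a"

definition poly_const :: "'a::comm_ring_1 \<Rightarrow> 'a jpoly" where
  "poly_const c = Poly_Mapping.single 0 c"

definition poly_var :: "jidx \<Rightarrow> 'a::comm_ring_1 jpoly" where
  "poly_var i = Poly_Mapping.single (Poly_Mapping.single i 1) 1"

definition generic_point :: "'a::comm_ring_1 jpoly herm" where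
  "generic_point = (\<chi> i. poly_var i)"

text \<open>
  The determinant as a polynomial is its value at the generic point, and its composition with a
  linear map is its value at the image of the generic point.  Over a small finite field it is
  not enough to compare values of the determinant at the points of the coordinate space.
\<close>

definition preserves_det :: "('a::comm_ring_1 herm \<Rightarrow> 'a herm) \<Rightarrow> bool" where
  "preserves_det f \<longleftrightarrow>
     dickson_freudenthal_det (map_matrix poly_const (matrix f) *v generic_point)
       = dickson_freudenthal_det (generic_point :: 'a jpoly herm)"

text \<open>
  Invertibility need not be demanded: a linear map that preserves this cubic form as a
  polynomial is injective, because the \<open>27\<close> partial derivatives of the form are linearly independent.
\<close>

definition SE6 :: "('a::field herm \<Rightarrow> 'a herm) monoid" where
  "SE6 = \<lparr>carrier = {f. Vector_Spaces.linear (*s) (*s) f \<and> preserves_det f},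
          mult = (\<circ>), one = id\<rparr>"

end

theory Submission
  imports Defs
begin

text \<open>
  The order is computed along a chain of stabilizers. The group preserves the polar forms of \<open>det\<close>,
  hence the white vectors, i.e. the nonzero points at which all partial derivatives of \<open>det\<close>
  vanish. Elementary shears are transitive on the ordered triples of white vectors \<open>(w, v, u)\<close>
  of the type of the three diagonal idempotents, and the stabilizer of these idempotents consists of
  the triples of orthogonal maps of the octonions that preserve \<open>Tr(ABC)\<close>. By the Moufang identity
  these are transitive on the \<open>B\<close> of norm \<open>1\<close>, and products of two left multiplications by
  elements of trace \<open>0\<close> show that the stabilizer of \<open>B = 1\<close> is transitive on the \<open>C\<close> of
  norm \<open>1\<close>. What fixes \<open>B = C = 1\<close> is the automorphism group of the octonions; it is transitive
  on the idempotents of trace \<open>1\<close>, and the stabilizer of \<open>e\<^sub>0\<close> acts on the span of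
  the three other \<open>e\<^sub>i\<close> with positive labels as \<open>SL\<^sub>3\<close>.
\<close>

section \<open>Split octonions\<close>

text \<open>The count has to work for every q, including q = 2, where the values of det at points do
  not determine the cubic form. Beyond linearity, what is used about a group element is read off
  from \<open>det_polar\<close> and \<open>det_tri\<close>. These come from the coefficient of t in
  det(x + t y) over F[t] and involve no division by 2 or 3. Conversely, each generator is a formula
  over any commutative ring, so its invariance can be checked over the polynomial ring. Finiteness
  takes care of inverses: an injective self-map of a finite space is bijective, and a finite set of
  bijections closed under composition is a group. The stages contribute (q^12-1)(q^9-1)/(q^4-1),
  then q^8 (q^4+1)(q^5-1), then q^16 for the three white vectors, q^3 (q^4-1) for each of the two
  octonions of norm 1, and q^6 (q^6-1)(q^2-1), the order of G2(q), for the automorphisms. The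
  denominator q^4-1 is absorbed by one of the norm-1 quadrics; the other completes q^4+1 to
  q^8-1.\<close>

definition oct_bil :: "'a::comm_ring_1 oct \<Rightarrow> 'a oct \<Rightarrow> 'a" where
  "oct_bil x y = (\<Sum>i\<in>UNIV. x $ Pos i * y $ Neg i + x $ Neg i * y $ Pos i)"

lemmas oct_simps = oct_eval oct_bil_def

lemma oct_mult_distrib:
  "(x + y) \<odot> z = x \<odot> z + y \<odot> z" "z \<odot> (x + y) = z \<odot> x + z \<odot> y"
  by (simp_all add: oct_simps algebra_simps)

lemma oct_mult_diff:
  "(x - y) \<odot> z = x \<odot> z - y \<odot> z" "z \<odot> (x - y) = z \<odot> x - z \<odot> y"
  by (simp_all add: oct_simps algebra_simps)

lemma oct_mult_scale: "(c *s x) \<odot> y = c *s (x \<odot> y)" "x \<odot> (c *s y) = c *s (x \<odot> y)"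
  by (simp_all add: oct_simps algebra_simps)

lemma oct_mult_zero [simp]: "0 \<odot> x = 0" "x \<odot> 0 = 0"
  by (simp_all add: oct_simps)

lemma oct_mult_minus: "(- x) \<odot> y = - (x \<odot> y)" "x \<odot> (- y) = - (x \<odot> y)"
  by (simp_all add: oct_simps)

lemma oct_cnj_linear:
  "oct_cnj (x + y) = oct_cnj x + oct_cnj y" "oct_cnj (c *s x) = c *s oct_cnj x"
  "oct_cnj (- x) = - oct_cnj x"  "oct_cnj (x - y) = oct_cnj x - oct_cnj y"
  by (simp_all add: oct_simps)

lemma oct_cnj_simps [simp]:
  "oct_cnj (oct_cnj x) = x" "oct_cnj 0 = 0" "oct_cnj oct_one = oct_one"
  "oct_norm (oct_cnj x) = oct_norm x" "oct_trace (oct_cnj x) = oct_trace x"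
  by (simp_all add: oct_simps algebra_simps)

lemma oct_cnj_eq_iff: "oct_cnj x = oct_cnj y \<longleftrightarrow> x = y"
  by (metis oct_cnj_simps(1))

lemma oct_bil_simps [simp]: "oct_bil 0 x = 0" "oct_bil x 0 = 0" "oct_norm 0 = 0" "oct_trace 0 = 0"
  "oct_norm oct_one = 1"
  by (simp_all add: oct_simps)

lemma oct_bil_linear:
  "oct_bil (x + y) z = oct_bil x z + oct_bil y z" "oct_bil z (x + y) = oct_bil z x + oct_bil z y"
  "oct_bil (x - y) z = oct_bil x z - oct_bil y z" "oct_bil z (x - y) = oct_bil z x - oct_bil z y"
  "oct_bil (c *s x) z = c * oct_bil x z" "oct_bil z (c *s x) = c * oct_bil z x"
  "oct_bil (- x) z = - oct_bil x z" "oct_bil z (- x) = - oct_bil z x"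
  by (simp_all add: oct_simps algebra_simps)

lemma oct_trace_linear:
  "oct_trace (x + y) = oct_trace x + oct_trace y" "oct_trace (x - y) = oct_trace x - oct_trace y"
  "oct_trace (c *s x) = c * oct_trace x" "oct_trace (- x) = - oct_trace x"
  by (simp_all add: oct_simps algebra_simps)

lemma oct_norm_scale: "oct_norm (c *s x) = c ^ 2 * oct_norm x" "oct_norm (- x) = oct_norm x"
  by (simp_all add: oct_simps algebra_simps power2_eq_square)

lemma oct_bil_commute: "oct_bil x y = oct_bil y x"
  by (simp add: oct_simps algebra_simps)

lemma oct_trace_mult: "oct_trace (x \<odot> y) = oct_bil x (oct_cnj y)"
  by (simp add: oct_simps algebra_simps)

lemma oct_bil_one: "oct_bil x oct_one = oct_trace x" "oct_bil oct_one x = oct_trace x"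
  by (simp_all add: oct_simps algebra_simps)

lemma oct_trace_commute: "oct_trace (x \<odot> y) = oct_trace (y \<odot> x)"
  by (simp add: oct_simps algebra_simps)

lemma oct_norm_add: "oct_norm (x + y) = oct_norm x + oct_norm y + oct_bil x y"
  by (simp add: oct_simps algebra_simps)

lemma oct_bil_self: "oct_bil x x = 2 * oct_norm x"
  by (simp add: oct_simps algebra_simps)

lemma oct_cnj_mult_cancel:
  "oct_cnj x \<odot> (x \<odot> y) = oct_norm x *s y" "x \<odot> (oct_cnj x \<odot> y) = oct_norm x *s y"
  "(y \<odot> x) \<odot> oct_cnj x = oct_norm x *s y" "(y \<odot> oct_cnj x) \<odot> x = oct_norm x *s y"
  by (simp_all add: oct_simps algebra_simps)

text \<open>Linearization of \<open>oct_cnj_mult_cancel\<close> in x. When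
  \<open>oct_bil x y = 1\<close> it splits every z into two pieces, which is how annihilators are
  counted.\<close>

lemma oct_cnj_mult_bil:
  "oct_cnj x \<odot> (y \<odot> z) + oct_cnj y \<odot> (x \<odot> z) = oct_bil x y *s z"
  by (simp add: oct_simps algebra_simps)

lemma oct_norm_mult: "oct_norm (x \<odot> y) = oct_norm x * oct_norm y"
  by (simp add: oct_simps algebra_simps)

lemma oct_cnj_eq: "oct_cnj x = oct_trace x *s oct_one - x"
  by (simp add: oct_simps)

text \<open>This left Moufang identity is the substitute for associativity behind both families of
  non-automorphic generators of the frame stabilizer.\<close>

lemma oct_moufang: "((u \<odot> x) \<odot> u) \<odot> y = u \<odot> (x \<odot> (u \<odot> y))"
  by (simp add: oct_simps algebra_simps)

text \<open>The basis is dual to itself up to negating labels, so pairing with the basis vector at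
  \<open>neg_idx i\<close> isolates the coordinate i; this is independent of the
  characteristic.\<close>

lemma oct_bil_nondegenerate:
  fixes x :: "'a::comm_ring_1 oct"
  assumes "\<And>y. oct_bil x y = 0" shows "x = 0"
proof -
  have "x $ i = 0" for i
    using assms[of "axis (neg_idx i) 1"] by (cases i; rename_tac j; case_tac j) (simp_all add: oct_simps)
  then show ?thesis by (simp add: vec_eq_iff)
qed

lemma oct_bil_eqI: "(\<And>z. oct_bil x z = oct_bil y z) \<Longrightarrow> x = y"
  using oct_bil_nondegenerate[of "x - y"] by (simp add: oct_bil_linear)

lemma oct_bil_surj:
  fixes x :: "'a::field oct"
  assumes "x \<noteq> 0" shows "\<exists>y. oct_bil y x = c"
proof -
  obtain y where y: "oct_bil x y \<noteq> 0" using oct_bil_nondegenerate assms by blast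
  then have "oct_bil ((c / oct_bil x y) *s y) x = c"
    by (simp add: oct_bil_linear oct_bil_commute[of y])
  then show ?thesis by blast
qed

lemma oct_norm_surj: "\<exists>x::'a::field oct. oct_norm x = c"
  by (rule exI[of _ "c *s axis (Pos I0) 1 + axis (Neg I0) 1"]) (simp add: oct_simps)

section \<open>Hermitian matrices\<close>

definition herm :: "'a \<Rightarrow> 'a \<Rightarrow> 'a \<Rightarrow> 'a oct \<Rightarrow> 'a oct \<Rightarrow> 'a oct \<Rightarrow> 'a herm" where
  "herm a b c A B C = (\<chi> j. case j of Ja \<Rightarrow> a | Jb \<Rightarrow> b | Jc \<Rightarrow> c
     | JA i \<Rightarrow> A $ i | JB i \<Rightarrow> B $ i | JC i \<Rightarrow> C $ i)"

definition octA :: "'a herm \<Rightarrow> 'a oct" where "octA x = (\<chi> i. x $ JA i)"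
definition octB :: "'a herm \<Rightarrow> 'a oct" where "octB x = (\<chi> i. x $ JB i)"
definition octC :: "'a herm \<Rightarrow> 'a oct" where "octC x = (\<chi> i. x $ JC i)"

lemma herm_nth [simp]:
  "herm a b c A B C $ Ja = a" "herm a b c A B C $ Jb = b" "herm a b c A B C $ Jc = c"
  "octA (herm a b c A B C) = A" "octB (herm a b c A B C) = B" "octC (herm a b c A B C) = C"
  by (simp_all add: herm_def octA_def octB_def octC_def vec_eq_iff)

lemma herm_eta: "herm (x $ Ja) (x $ Jb) (x $ Jc) (octA x) (octB x) (octC x) = x"
  by (simp add: herm_def octA_def octB_def octC_def vec_eq_iff split: jidx.split)

lemma herm_cases: obtains a b c A B C where "x = herm a b c A B C"
  using herm_eta by metis

lemma herm_eq_iff [simp]: "herm a b c A B C = herm a' b' c' A' B' C' \<longleftrightarrow>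
    a = a' \<and> b = b' \<and> c = c' \<and> A = A' \<and> B = B' \<and> C = C'"
  by (metis herm_nth)

lemma herm_eqI: "x $ Ja = y $ Ja \<Longrightarrow> x $ Jb = y $ Jb \<Longrightarrow> x $ Jc = y $ Jc \<Longrightarrow> octA x = octA y
   \<Longrightarrow> octB x = octB y \<Longrightarrow> octC x = octC y \<Longrightarrow> x = y"
  by (metis herm_eta)

lemma herm_zero: "herm 0 0 0 0 0 0 = 0"
  by (simp add: herm_def vec_eq_iff split: jidx.split)

lemma herm_add: "herm a b c A B C + herm a' b' c' A' B' C'
    = herm (a + a') (b + b') (c + c') (A + A') (B + B') (C + C')"
  by (simp add: herm_def vec_eq_iff split: jidx.split)

lemma herm_scale: "r *s herm a b c A B C = herm (r * a) (r * b) (r * c) (r *s A) (r *s B) (r *s C)"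
  by (simp add: herm_def vec_eq_iff split: jidx.split)

lemma oct_of_linear:
  "octA (x + y) = octA x + octA y" "octB (x + y) = octB x + octB y" "octC (x + y) = octC x + octC y"
  "octA (r *s x) = r *s octA x" "octB (r *s x) = r *s octB x" "octC (r *s x) = r *s octC x"
  by (simp_all add: octA_def octB_def octC_def vec_eq_iff)

lemma det_eq: "dickson_freudenthal_det x = x $ Ja * x $ Jb * x $ Jc - x $ Ja * oct_norm (octA x)
    - x $ Jb * oct_norm (octB x) - x $ Jc * oct_norm (octC x) + oct_trace (octA x \<odot> (octB x \<odot> octC x))"
  by (simp add: dickson_freudenthal_det_def octA_def octB_def octC_def Let_def)

lemma det_herm: "dickson_freudenthal_det (herm a b c A B C) =
    a * b * c - a * oct_norm A - b * oct_norm B - c * oct_norm C + oct_trace (A \<odot> (B \<odot> C))"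
  by (simp add: det_eq)

section \<open>Polarizations of the determinant\<close>

definition det_polar :: "'a::comm_ring_1 herm \<Rightarrow> 'a herm \<Rightarrow> 'a" where
  "det_polar x y = y $ Ja * (x $ Jb * x $ Jc - oct_norm (octA x))
     + y $ Jb * (x $ Jc * x $ Ja - oct_norm (octB x))
     + y $ Jc * (x $ Ja * x $ Jb - oct_norm (octC x))
     - x $ Ja * oct_bil (octA x) (octA y) - x $ Jb * oct_bil (octB x) (octB y)
     - x $ Jc * oct_bil (octC x) (octC y)
     + oct_trace (octA y \<odot> (octB x \<odot> octC x)) + oct_trace (octA x \<odot> (octB y \<odot> octC x))
     + oct_trace (octA x \<odot> (octB x \<odot> octC y))"

text \<open>Identifies \<open>det_polar x y\<close> as the derivative of det at x in the direction
  y: quadratic in x, linear in y. The ring is arbitrary because t will later be an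
  indeterminate.\<close>

lemma det_add_scale:
  "dickson_freudenthal_det (x + t *s y) = dickson_freudenthal_det x + t * det_polar x y
     + t ^ 2 * det_polar y x + t ^ 3 * dickson_freudenthal_det y"
  by (cases x rule: herm_cases; cases y rule: herm_cases)
    (simp add: det_polar_def det_herm herm_add herm_scale oct_norm_add oct_norm_scale oct_bil_linear
      oct_mult_distrib oct_mult_scale oct_trace_linear algebra_simps power2_eq_square power3_eq_cube
      oct_bil_commute)

text \<open>The full polarization, a symmetric trilinear form that takes the value 6 det(x) on the
  diagonal; it is formed by differences and so makes sense in characteristics 2 and 3.\<close>

definition det_tri :: "'a::comm_ring_1 herm \<Rightarrow> 'a herm \<Rightarrow> 'a herm \<Rightarrow> 'a" where
  "det_tri x y z = det_polar (x + y) z - det_polar x z - det_polar y z"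

lemma det_tri_herm: "det_tri (herm a b c A B C) (herm a' b' c' A' B' C') (herm a'' b'' c'' A'' B'' C'') =
    a'' * (b * c' + c * b' - oct_bil A A') + b'' * (c * a' + a * c' - oct_bil B B') +
    c'' * (a * b' + b * a' - oct_bil C C') - a * oct_bil A' A'' - a' * oct_bil A A''
    - b * oct_bil B' B'' - b' * oct_bil B B'' - c * oct_bil C' C'' - c' * oct_bil C C''
    + oct_trace (A'' \<odot> (B \<odot> C' + B' \<odot> C)) + oct_trace (A \<odot> (B'' \<odot> C') + A' \<odot> (B'' \<odot> C))
    + oct_trace (A \<odot> (B' \<odot> C'') + A' \<odot> (B \<odot> C''))"
  by (simp add: det_tri_def det_polar_def herm_add oct_norm_add oct_bil_linear
      oct_mult_distrib oct_mult_scale oct_trace_linear algebra_simps)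

text \<open>The map x -> T x T*, where T is the identity matrix plus X in position (1,2), expanded
  in coordinates since products of octonion matrices are not associative. In \<open>shear21\<close>
  the matrix has the conjugate of X in position (2,1).\<close>

definition shear12 :: "'a::comm_ring_1 oct \<Rightarrow> 'a herm \<Rightarrow> 'a herm" where
  "shear12 X x = herm (x $ Ja + oct_bil X (octC x) + oct_norm X * x $ Jb) (x $ Jb) (x $ Jc)
     (octA x) (octB x + oct_cnj (X \<odot> octA x)) (octC x + x $ Jb *s X)"

definition shear21 :: "'a::comm_ring_1 oct \<Rightarrow> 'a herm \<Rightarrow> 'a herm" where
  "shear21 X x = herm (x $ Ja) (x $ Jb + oct_bil X (octC x) + oct_norm X * x $ Ja) (x $ Jc)
     (octA x + oct_cnj (octB x \<odot> X)) (octB x) (octC x + x $ Ja *s X)"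

lemma det_shear12: "dickson_freudenthal_det (shear12 X x) = dickson_freudenthal_det x"
  by (simp add: shear12_def det_eq oct_simps algebra_simps)

lemma det_shear21: "dickson_freudenthal_det (shear21 X x) = dickson_freudenthal_det x"
  by (simp add: shear21_def det_eq oct_simps algebra_simps)

text \<open>A cyclic permutation of rows and columns; conjugation by it transports the two shears to
  the other pairs of indices.\<close>

definition rotate_herm :: "'a herm \<Rightarrow> 'a herm" where
  "rotate_herm x = herm (x $ Jb) (x $ Jc) (x $ Ja) (octB x) (octC x) (octA x)"

lemma det_rotate_herm: "dickson_freudenthal_det (rotate_herm x) = dickson_freudenthal_det x"
  by (simp add: rotate_herm_def det_eq oct_simps algebra_simps)

section \<open>The group as a group of permutations\<close>

definition ring_map :: "('a::comm_ring_1 \<Rightarrow> 'b::comm_ring_1) \<Rightarrow> bool" where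
  "ring_map h \<longleftrightarrow> h 1 = 1 \<and> (\<forall>x y. h (x + y) = h x + h y) \<and> (\<forall>x y. h (x * y) = h x * h y)"

definition map_vec :: "('a \<Rightarrow> 'b) \<Rightarrow> 'a ^ 'n \<Rightarrow> 'b ^ 'n" where
  "map_vec h x = (\<chi> i. h (x $ i))"

lemma map_vec_nth [simp]: "map_vec h x $ i = h (x $ i)"
  by (simp add: map_vec_def)

context
  fixes h :: "'a::comm_ring_1 \<Rightarrow> 'b::comm_ring_1"
  assumes h: "ring_map h"
begin

lemma ring_map_simps:
  "h 1 = 1" "h (x + y) = h x + h y" "h (x * y) = h x * h y" "h 0 = 0" "h (- x) = - h x"
  "h (x - y) = h x - h y"
proof -
  show *: "h 1 = 1" "h (x + y) = h x + h y" "h (x * y) = h x * h y" for x y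
    using h by (auto simp: ring_map_def)
  have "h 0 + h 0 = h 0" by (metis *(2) add_0)
  then show 0: "h 0 = 0" by simp
  show 1: "h (- x) = - h x" for x
    by (metis *(2) 0 add_eq_0_iff add.right_inverse)
  show "h (x - y) = h x - h y"
    by (metis *(2) 1 diff_conv_add_uminus)
qed

lemma ring_map_sum: "h (sum f I) = (\<Sum>i\<in>I. h (f i))"
  by (induction I rule: infinite_finite_induct) (simp_all add: ring_map_simps)

lemma map_vec_oct:
  "map_vec h (x \<odot> y) = map_vec h x \<odot> map_vec h y" "map_vec h (oct_cnj x) = oct_cnj (map_vec h x)"
  "map_vec h (x + z) = map_vec h x + map_vec h z"
  "map_vec h (c *s x) = h c *s map_vec h x"
  "h (oct_norm x) = oct_norm (map_vec h x)" "h (oct_bil x y) = oct_bil (map_vec h x) (map_vec h y)"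
  "h (oct_trace x) = oct_trace (map_vec h x)"
  by (simp_all add: oct_simps ring_map_simps)

lemma map_vec_herm:
  "map_vec h (herm a b c A B C) = herm (h a) (h b) (h c) (map_vec h A) (map_vec h B) (map_vec h C)"
  "octA (map_vec h x) = map_vec h (octA x)" "octB (map_vec h x) = map_vec h (octB x)"
  "octC (map_vec h x) = map_vec h (octC x)"
  "map_vec h (x + y) = map_vec h x + map_vec h y" "map_vec h (c *s x) = h c *s map_vec h x"
  by (simp_all add: vec_eq_iff herm_def octA_def octB_def octC_def ring_map_simps split: jidx.split)

lemma map_vec_det: "h (dickson_freudenthal_det x) = dickson_freudenthal_det (map_vec h x)"
  by (simp add: det_eq ring_map_simps map_vec_oct map_vec_herm)

lemma map_vec_polar: "h (det_polar x y) = det_polar (map_vec h x) (map_vec h y)"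
  by (simp add: det_polar_def ring_map_simps map_vec_oct map_vec_herm)

text \<open>The ring homomorphism that extends \<open>h\<close> on constants and sends the
  indeterminates to the coordinates of v.\<close>

definition jpoly_eval :: "'b herm \<Rightarrow> 'a jpoly \<Rightarrow> 'b" where
  "jpoly_eval v p = (\<Sum>m\<in>Poly_Mapping.keys p.
     h (Poly_Mapping.lookup p m) * (\<Prod>i\<in>UNIV. v $ i ^ Poly_Mapping.lookup m i))"

lemma jpoly_eval_superset:
  assumes "finite S" "Poly_Mapping.keys p \<subseteq> S"
  shows "jpoly_eval v p = (\<Sum>m\<in>S.
    h (Poly_Mapping.lookup p m) * (\<Prod>i\<in>UNIV. v $ i ^ Poly_Mapping.lookup m i))"
  unfolding jpoly_eval_def using assms
  by (intro sum.mono_neutral_left) (auto simp: in_keys_iff ring_map_simps)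

lemma jpoly_eval_add: "jpoly_eval v (p + r) = jpoly_eval v p + jpoly_eval v r"
proof -
  let ?S = "Poly_Mapping.keys p \<union> Poly_Mapping.keys r"
  have "Poly_Mapping.keys (p + r) \<subseteq> ?S" by (rule keys_add)
  then show ?thesis
    by (simp add: jpoly_eval_superset[of ?S] lookup_add ring_map_simps distrib_right sum.distrib)
qed

lemma jpoly_eval_single: "jpoly_eval v (Poly_Mapping.single m c)
    = h c * (\<Prod>i\<in>UNIV. v $ i ^ Poly_Mapping.lookup m i)"
  by (subst jpoly_eval_superset[of "{m}"]) auto

lemma jpoly_eval_sum: "jpoly_eval v (sum f I) = (\<Sum>i\<in>I. jpoly_eval v (f i))"
proof -
  have "jpoly_eval v 0 = 0" by (simp add: jpoly_eval_def)
  then show ?thesis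
    by (induction I rule: infinite_finite_induct) (simp_all add: jpoly_eval_add)
qed

lemma jpoly_eval_mult: "jpoly_eval v (p * r) = jpoly_eval v p * jpoly_eval v r"
proof -
  have expand: "p = (\<Sum>m\<in>Poly_Mapping.keys p. Poly_Mapping.single m (Poly_Mapping.lookup p m))" for
    p :: "'a jpoly"
    by (rule poly_mapping_eqI) (auto simp: lookup_sum lookup_single when_def sum.delta in_keys_iff)
  have single: "jpoly_eval v (Poly_Mapping.single m c * Poly_Mapping.single n d)
      = jpoly_eval v (Poly_Mapping.single m c) * jpoly_eval v (Poly_Mapping.single n d)" for m n c d
    by (simp add: mult_single jpoly_eval_single lookup_add power_add prod.distrib ring_map_simps)
  show ?thesis
    by (subst (1 2 3 4) expand) (simp only: sum_product jpoly_eval_sum single)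
qed

lemma ring_map_jpoly_eval: "ring_map (jpoly_eval v)"
proof -
  have "jpoly_eval v 1 = 1"
    using jpoly_eval_single[of v 0 1] by (simp add: ring_map_simps)
  then show ?thesis
    by (simp add: ring_map_def jpoly_eval_add jpoly_eval_mult)
qed

lemma jpoly_eval_const: "jpoly_eval v (poly_const c) = h c"
  by (simp add: poly_const_def jpoly_eval_single)

lemma jpoly_eval_var: "jpoly_eval v (poly_var i) = v $ i"
proof -
  have "(\<Prod>j\<in>UNIV. v $ j ^ (if i = j then Suc 0 else 0)) = (\<Prod>j\<in>UNIV. if j = i then v $ j else 1)"
    by (intro prod.cong) auto
  then show ?thesis
    by (simp add: poly_var_def jpoly_eval_single lookup_single when_def ring_map_simps)
qed

end

lemma matrix_vector_scale: "M *v (c *s v) = c *s (M *v (v :: 'a::comm_ring_1 ^ 'n))"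
  by (simp add: vec_eq_iff matrix_vector_mult_def sum_distrib_left mult_ac)

lemma map_vec_matrix:
  assumes "ring_map h"
  shows "map_vec h (M *v v) = map_matrix h M *v map_vec h v"
  by (simp add: vec_eq_iff matrix_vector_mult_def ring_map_sum[OF assms] ring_map_simps[OF assms])

text \<open>An identity at the generic point specializes to every point over every commutative ring
  that receives the base: send the indeterminates to the coordinates of v.\<close>

lemma preserves_det_eval:
  assumes "preserves_det f" "ring_map h"
  shows "dickson_freudenthal_det (map_matrix h (matrix f) *v v) = dickson_freudenthal_det v"
proof -
  note e = ring_map_jpoly_eval[OF assms(2), of v]
  have 1: "map_vec (jpoly_eval h v) generic_point = v"
    by (simp add: vec_eq_iff generic_point_def jpoly_eval_var[OF assms(2)])
  have 2: "map_matrix (jpoly_eval h v) (map_matrix poly_const (matrix f)) = map_matrix h (matrix f)"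
    by (simp add: vec_eq_iff jpoly_eval_const[OF assms(2)])
  have "jpoly_eval h v (dickson_freudenthal_det (map_matrix poly_const (matrix f) *v generic_point))
      = jpoly_eval h v (dickson_freudenthal_det generic_point)"
    using assms(1) by (simp add: preserves_det_def)
  then show ?thesis
    by (simp add: map_vec_det[OF e] map_vec_matrix[OF e] 1 2)
qed

lemma ring_map_poly_const: "ring_map poly_const"
  by (simp add: ring_map_def poly_const_def single_add mult_single)

lemma ring_map_pCons: "ring_map (\<lambda>c. [:c:] :: 'a::comm_ring_1 poly)"
  by (simp add: ring_map_def one_pCons)

section \<open>Elements of the group and the forms that they preserve\<close>

abbreviation SE6_carrier :: "('a::field herm \<Rightarrow> 'a herm) set" where
  "SE6_carrier \<equiv> carrier SE6"

lemma linear_vec_iff: "Vector_Spaces.linear (*s) (*s) f \<longleftrightarrow>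
    (\<forall>x y. f (x + y) = f x + f y) \<and> (\<forall>c x. f (c *s x) = c *s f (x :: 'a::field ^ 'n))"
  by (simp add: Vector_Spaces.linear_iff vec.vector_space_axioms)

lemma SE6_linear:
  assumes "f \<in> SE6_carrier"
  shows "f (x + y) = f x + f y" "f (c *s x) = c *s f x" "f 0 = 0" "f (x - y) = f x - f y" "f (- x)
    = - f x"
proof -
  have l: "Vector_Spaces.linear (*s) (*s) f" using assms by (simp add: SE6_def)
  show "f (x + y) = f x + f y" "f (c *s x) = c *s f x" using l by (auto simp: linear_vec_iff)
  show "f 0 = 0" "f (x - y) = f x - f y" "f (- x) = - f x"
    by (rule vec.linear_0[OF l] vec.linear_diff[OF l] vec.linear_neg[OF l])+
qed

lemma SE6_matrix: "f \<in> SE6_carrier \<Longrightarrow> matrix f *v x = f x"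
  by (intro matrix_works) (simp add: SE6_def)

text \<open>Specializing to x + t y over \<open>'a poly\<close> gives an equality of polynomials in
  t, and the polar form is the coefficient of t. Comparing values at the elements t of a small field
  would not isolate this coefficient.\<close>

lemma SE6_polar:
  assumes "f \<in> SE6_carrier"
  shows "det_polar (f x) (f y) = det_polar x y"
proof -
  let ?h = "\<lambda>c. [:c:] :: 'a poly"
  note h = ring_map_pCons
  have f: "preserves_det f" using assms by (simp add: SE6_def)
  have "map_matrix ?h (matrix f) *v (map_vec ?h x + [:0, 1:] *s map_vec ?h y)
      = map_vec ?h (f x) + [:0, 1:] *s map_vec ?h (f y)"
    by (simp add: matrix_vector_right_distrib matrix_vector_scale SE6_matrix[OF assms] flip:
      map_vec_matrix[OF h])
  then have "dickson_freudenthal_det (map_vec ?h (f x) + [:0, 1:] *s map_vec ?h (f y))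
     = dickson_freudenthal_det (map_vec ?h x + [:0, 1:] *s map_vec ?h y)"
    using preserves_det_eval[OF f h, of "map_vec ?h x + [:0, 1:] *s map_vec ?h y"] by simp
  then have "coeff ([:dickson_freudenthal_det (f x):] + [:0, 1:] * [:det_polar (f x) (f y):]
     + [:0, 1:] ^ 2 * [:det_polar (f y) (f x):] + [:0, 1:] ^ 3 * [:dickson_freudenthal_det (f y):]) 1
    = coeff ([:dickson_freudenthal_det x:] + [:0, 1:] * [:det_polar x y:]
     + [:0, 1:] ^ 2 * [:det_polar y x:] + [:0, 1:] ^ 3 * [:dickson_freudenthal_det y:]) 1"
    by (simp only: det_add_scale map_vec_det[OF h] map_vec_polar[OF h])
  then show ?thesis by (simp add: power2_eq_square power3_eq_cube)
qed

lemma SE6_tri: "f \<in> SE6_carrier \<Longrightarrow> det_tri (f x) (f y) (f z) = det_tri x y z"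
  by (simp add: det_tri_def SE6_polar flip: SE6_linear)

text \<open>The determinant must be preserved over the polynomial ring, so each generator comes with an
  extension \<open>F\<close> to that ring, given by the same formula.\<close>

lemma SE6I:
  fixes f :: "'a::field herm \<Rightarrow> 'a herm" and F :: "'a jpoly herm \<Rightarrow> 'a jpoly herm"
  assumes "\<And>x y. f (x + y) = f x + f y" "\<And>c x. f (c *s x) = c *s f x"
    and F: "\<And>x y. F (x + y) = F x + F y" "\<And>c x. F (c *s x) = c *s F x"
    and ext: "\<And>x. F (map_vec poly_const x) = map_vec poly_const (f x)"
    and det: "\<And>x. dickson_freudenthal_det (F x) = dickson_freudenthal_det x"
  shows "f \<in> SE6_carrier"
proof -
  note pc = ring_map_poly_const
  have F_sum: "F (sum g I) = (\<Sum>i\<in>I. F (g i))" for g :: "jidx \<Rightarrow> _" and I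
    using F(2)[of 0 0] by (induction I rule: infinite_finite_induct) (simp_all add: F(1))
  have ax: "F (axis j 1) = map_vec poly_const (f (axis j 1))" for j
  proof -
    have "axis j 1 = map_vec poly_const (axis j (1::'a))"
      by (simp add: vec_eq_iff axis_def ring_map_simps[OF pc])
    then show ?thesis by (simp add: ext)
  qed
  \<comment> \<open>Both sides are linear over the polynomial ring, and \<open>ax\<close> compares
    them on the unit vectors, whose coordinates are constants.\<close>
  have "map_matrix poly_const (matrix f) *v v = F v" for v
  proof -
    have "F v = F (\<Sum>j\<in>UNIV. v $ j *s axis j 1)" by (simp add: basis_expansion)
    also have "\<dots> = (\<Sum>j\<in>UNIV. v $ j *s map_vec poly_const (f (axis j 1)))"
      by (simp add: F_sum F(2) ax)
    also have "\<dots> = map_matrix poly_const (matrix f) *v v"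
      by (simp add: vec_eq_iff matrix_vector_mult_def matrix_def mult.commute)
    finally show ?thesis ..
  qed
  then show ?thesis using assms(1,2)
    by (simp add: SE6_def linear_vec_iff preserves_det_def det)
qed

section \<open>Finite permutation groups and orbit counting\<close>

definition perm_group :: "('b \<Rightarrow> 'b) set \<Rightarrow> bool" where
  "perm_group H \<longleftrightarrow> finite H \<and> id \<in> H \<and> (\<forall>f\<in>H. \<forall>g\<in>H. f \<circ> g \<in> H) \<and> (\<forall>f\<in>H. bij f)"

definition stabilizer :: "('b \<Rightarrow> 'b) set \<Rightarrow> 'b \<Rightarrow> ('b \<Rightarrow> 'b) set" where
  "stabilizer H v = {f \<in> H. f v = v}"

lemma perm_group_stabilizer: "perm_group H \<Longrightarrow> perm_group (stabilizer H v)"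
  by (auto simp: perm_group_def stabilizer_def)

lemma perm_group_comp: "perm_group H \<Longrightarrow> f \<in> H \<Longrightarrow> g \<in> H \<Longrightarrow> f \<circ> g \<in> H"
  by (simp add: perm_group_def)

text \<open>Left composition with f is injective on the finite set H, hence onto, and the element
  that it sends to \<open>id\<close> is the inverse.\<close>

lemma perm_group_inv:
  assumes H: "perm_group H" and f: "f \<in> H"
  shows "inv_into UNIV f \<in> H"
proof -
  have b: "bij f" using H f by (simp add: perm_group_def)
  then have "inj_on ((\<circ>) f) H" by (intro inj_onI) (metis bij_is_inj inv_o_cancel fun.map_comp id_comp)
  moreover have "(\<circ>) f ` H \<subseteq> H" using H f by (auto simp: perm_group_def)
  ultimately have "(\<circ>) f ` H = H" using H by (simp add: endo_inj_surj perm_group_def)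
  then obtain g where "g \<in> H" "f \<circ> g = id" using H by (metis imageE perm_group_def)
  then have "inv_into UNIV f = g" using b by (metis bij_is_inj comp_id fun.map_comp id_comp inv_o_cancel)
  then show ?thesis using \<open>g \<in> H\<close> by simp
qed

text \<open>The fibres of evaluation at v are cosets of the stabilizer. Transitivity is asked in the
  form "every x can be moved to v" because that is what reductions to a normal form deliver.\<close>

lemma card_orbit_stabilizer:
  assumes H: "perm_group H" and S: "\<And>f. f \<in> H \<Longrightarrow> f v \<in> S" "\<And>x. x \<in> S \<Longrightarrow> \<exists>f\<in>H. f x = v" and fin: "finite S"
  shows "card H = card S * card (stabilizer H v)"
proof -
  have fibre: "card {f \<in> H. f v = x} = card (stabilizer H v)" if xS: "x \<in> S" for x
  proof -
    obtain g where g: "g \<in> H" "g x = v" using S(2)[OF xS] by blast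
    then have b: "bij g" using H by (simp add: perm_group_def)
    have "bij_betw ((\<circ>) g) {f \<in> H. f v = x} (stabilizer H v)"
    proof (rule bij_betwI[of _ _ _ "(\<circ>) (inv_into UNIV g)"])
      show "(\<circ>) g \<in> {f \<in> H. f v = x} \<rightarrow> stabilizer H v"
        using H g by (auto simp: stabilizer_def perm_group_def)
      show "(\<circ>) (inv_into UNIV g) \<in> stabilizer H v \<rightarrow> {f \<in> H. f v = x}"
        using H g perm_group_inv[OF H g(1)] b
        by (auto simp: stabilizer_def perm_group_def bij_is_inj inv_f_eq)
    qed (use b in \<open>auto simp: fun_eq_iff bij_is_inj bij_is_surj surj_f_inv_f\<close>)
    then show ?thesis by (rule bij_betw_same_card)
  qed
  have "card H = (\<Sum>x\<in>S. card {f \<in> H. f v = x})"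
    using sum.group[of H S "\<lambda>f. f v" "\<lambda>_. 1::nat"] H S(1) fin
      by (simp add: perm_group_def image_subset_iff)
  then show ?thesis using fibre by simp
qed

text \<open>The form is quadratic in y, so sums of two diagonal idempotents isolate a diagonal
  coordinate of x; one idempotent together with z then pairs z with an octonion coordinate.\<close>

lemma det_polar_nondegenerate:
  fixes x :: "'a::field herm"
  assumes "\<And>y. det_polar y x = 0" shows "x = 0"
proof (cases x rule: herm_cases)
  case (1 a b c A B C)
  have "a = 0" "b = 0" "c = 0"
    using assms[of "herm 0 1 1 0 0 0"] assms[of "herm 1 0 1 0 0 0"] assms[of "herm 1 1 0 0 0 0"]
    by (simp_all add: 1 det_polar_def)
  moreover from this have "oct_bil A z = 0" "oct_bil B z = 0" "oct_bil C z = 0" for z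
    using assms[of "herm 1 0 0 z 0 0"] assms[of "herm 0 1 0 0 z 0"] assms[of "herm 0 0 1 0 0 z"]
    by (simp_all add: 1 det_polar_def oct_bil_commute)
  ultimately show ?thesis by (metis 1 herm_zero oct_bil_nondegenerate)
qed

lemma SE6_inj:
  assumes "f \<in> SE6_carrier" shows "inj f"
proof (rule injI)
  fix x y assume eq: "f x = f y"
  have "det_polar z (x - y) = 0" for z
    using SE6_polar[OF assms, of z "x - y"]
    by (simp add: SE6_linear[OF assms] eq det_polar_def octA_def octB_def octC_def oct_simps)
  then show "x = y" using det_polar_nondegenerate by (metis eq_iff_diff_eq_0)
qed

text \<open>The identity for f is applied at the image of the generic point under g, which is a
  vector over the polynomial ring and not over the field.\<close>

lemma SE6_comp:
  assumes f: "f \<in> SE6_carrier" and g: "g \<in> SE6_carrier" shows "f \<circ> g \<in> SE6_carrier"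
proof -
  have l: "Vector_Spaces.linear (*s) (*s) f" "Vector_Spaces.linear (*s) (*s) g" "preserves_det f"
    "preserves_det g"
    using f g by (auto simp: SE6_def)
  note pc = ring_map_poly_const
  have "map_matrix poly_const (matrix (f \<circ> g)) = map_matrix poly_const (matrix f) ** map_matrix
    poly_const (matrix g)"
    by (simp add: matrix_compose_gen l vec_eq_iff matrix_matrix_mult_def ring_map_sum[OF pc]
      ring_map_simps[OF pc])
  then have "preserves_det (f \<circ> g)"
    using preserves_det_eval[OF l(3) pc] preserves_det_eval[OF l(4) pc]
    by (simp add: preserves_det_def flip: matrix_vector_mul_assoc)
  moreover have "Vector_Spaces.linear (*s) (*s) (f \<circ> g)" using l(1,2) by (auto simp: linear_vec_iff)
  ultimately show ?thesis by (simp add: SE6_def)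
qed

lemma SE6_id: "id \<in> SE6_carrier"
  by (rule SE6I[of _ id]) auto

lemma perm_group_SE6: "perm_group (SE6_carrier :: ('a::{field,finite} herm \<Rightarrow> _) set)"
  unfolding perm_group_def
  using SE6_comp SE6_id SE6_inj by (auto simp: bij_def intro!: finite_UNIV_inj_surj)

section \<open>Generators\<close>

lemma shear_linear:
  "shear12 X (x + y) = shear12 X x + shear12 X y" "shear12 X (c *s x) = c *s shear12 X x"
  "shear21 X (x + y) = shear21 X x + shear21 X y" "shear21 X (c *s x) = c *s shear21 X x"
  by (simp_all add: shear12_def shear21_def herm_add herm_scale oct_of_linear oct_bil_linear
    oct_cnj_linear
    oct_mult_distrib oct_mult_scale algebra_simps vector_sadd_rdistrib vector_smult_assoc
      vector_add_ldistrib)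

lemma map_vec_shear:
  assumes "ring_map h"
  shows "shear12 (map_vec h X) (map_vec h x) = map_vec h (shear12 X x)"
    "shear21 (map_vec h X) (map_vec h x) = map_vec h (shear21 X x)"
  by (simp_all add: shear12_def shear21_def map_vec_oct[OF assms] map_vec_herm[OF assms]
    ring_map_simps[OF assms])

lemma shear12_SE6: "shear12 X \<in> SE6_carrier"
  by (rule SE6I[of _ "shear12 (map_vec poly_const X)"])
    (simp_all add: shear_linear map_vec_shear ring_map_poly_const det_shear12)

lemma shear21_SE6: "shear21 X \<in> SE6_carrier"
  by (rule SE6I[of _ "shear21 (map_vec poly_const X)"])
    (simp_all add: shear_linear map_vec_shear ring_map_poly_const det_shear21)

lemma rotate_herm_SE6: "rotate_herm \<in> SE6_carrier"
  by (rule SE6I[of _ "rotate_herm"])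
    (simp_all add: rotate_herm_def herm_add herm_scale oct_of_linear ring_map_poly_const map_vec_herm
      det_rotate_herm[unfolded rotate_herm_def])

section \<open>Triples of octonion maps that preserve norms and the trace form\<close>

definition herm_map :: "('a oct \<Rightarrow> 'a oct) \<Rightarrow> ('a oct \<Rightarrow> 'a oct) \<Rightarrow> ('a oct \<Rightarrow> 'a oct) \<Rightarrow> 'a herm \<Rightarrow> 'a
  herm" where
  "herm_map \<alpha> \<beta> \<gamma> x = herm (x $ Ja) (x $ Jb) (x $ Jc) (\<alpha> (octA x)) (\<beta> (octB x)) (\<gamma> (octC x))"

definition oct_linear :: "('a::comm_ring_1 oct \<Rightarrow> 'a oct) \<Rightarrow> bool" where
  "oct_linear f \<longleftrightarrow> (\<forall>x y. f (x + y) = f x + f y) \<and> (\<forall>c x. f (c *s x) = c *s f x)"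

lemma herm_map_SE6:
  assumes lin: "oct_linear \<alpha>" "oct_linear \<beta>" "oct_linear \<gamma>" "oct_linear \<alpha>'" "oct_linear \<beta>'"
    "oct_linear \<gamma>'"
    and ext: "\<And>x. \<alpha>' (map_vec poly_const x) = map_vec poly_const (\<alpha> x)"
      "\<And>x. \<beta>' (map_vec poly_const x) = map_vec poly_const (\<beta> x)"
      "\<And>x. \<gamma>' (map_vec poly_const x) = map_vec poly_const (\<gamma> x)"
    and norm: "\<And>x. oct_norm (\<alpha>' x) = oct_norm x" "\<And>x. oct_norm (\<beta>' x) = oct_norm x" "\<And>x. oct_norm
      (\<gamma>' x) = oct_norm x"
    and tri: "\<And>x y z. oct_trace (\<alpha>' x \<odot> (\<beta>' y \<odot> \<gamma>' z)) = oct_trace (x \<odot> (y \<odot> z))"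
  shows "herm_map \<alpha> \<beta> \<gamma> \<in> SE6_carrier"
  by (rule SE6I[of _ "herm_map \<alpha>' \<beta>' \<gamma>'"])
    (use lin in \<open>simp_all add: herm_map_def oct_linear_def herm_add herm_scale oct_of_linear
      map_vec_herm ring_map_poly_const ext det_eq norm tri\<close>)

text \<open>Norm 1 makes the conjugate of u its inverse. The Moufang identity turns the product of
  the first two images into u(xy), and cyclic invariance of the trace brings this u next to the
  inverse carried by z.\<close>

lemma oct_trace_moufang:
  assumes u: "oct_norm u = 1"
  shows "oct_trace (((u \<odot> x) \<odot> u) \<odot> ((oct_cnj u \<odot> y) \<odot> (z \<odot> oct_cnj u))) = oct_trace (x \<odot> (y \<odot> z))"
proof -
  have "((u \<odot> x) \<odot> u) \<odot> (oct_cnj u \<odot> y) = u \<odot> (x \<odot> y)"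
    by (simp only: oct_moufang oct_cnj_mult_cancel u vector_smult_lid)
  then have "oct_trace (((u \<odot> x) \<odot> u) \<odot> ((oct_cnj u \<odot> y) \<odot> (z \<odot> oct_cnj u)))
      = oct_trace ((u \<odot> (x \<odot> y)) \<odot> (z \<odot> oct_cnj u))"
    by (simp only: oct_trace_assoc[of _ "oct_cnj u \<odot> y"])
  also have "\<dots> = oct_trace ((z \<odot> oct_cnj u) \<odot> (u \<odot> (x \<odot> y)))"
    by (rule oct_trace_commute)
  also have "\<dots> = oct_trace (z \<odot> (oct_cnj u \<odot> (u \<odot> (x \<odot> y))))"
    by (rule oct_trace_assoc[symmetric])
  also have "\<dots> = oct_trace (z \<odot> (x \<odot> y))"
    by (simp only: oct_cnj_mult_cancel u vector_smult_lid)
  also have "\<dots> = oct_trace ((x \<odot> y) \<odot> z)"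
    by (rule oct_trace_commute)
  also have "\<dots> = oct_trace (x \<odot> (y \<odot> z))"
    by (rule oct_trace_assoc[symmetric])
  finally show ?thesis .
qed

lemma herm_map_moufang_SE6:
  fixes u :: "'a::field oct"
  assumes u: "oct_norm u = 1"
  shows "herm_map (\<lambda>x. (u \<odot> x) \<odot> u) (\<lambda>x. oct_cnj u \<odot> x) (\<lambda>x. x \<odot> oct_cnj u) \<in> SE6_carrier"
proof -
  note pc = ring_map_poly_const[where 'a = 'a]
  let ?u = "map_vec poly_const u"
  have u': "oct_norm ?u = 1" using u by (simp flip: map_vec_oct[OF pc] add: ring_map_simps[OF pc])
  have tri: "oct_trace (((?u \<odot> x) \<odot> ?u) \<odot> ((oct_cnj ?u \<odot> y) \<odot> (z \<odot> oct_cnj ?u))) = oct_trace (x \<odot>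
    (y \<odot> z))" for x y z
    by (rule oct_trace_moufang[OF u'])
  show ?thesis
    by (rule herm_map_SE6[of _ _ _ "\<lambda>x. (?u \<odot> x) \<odot> ?u" "\<lambda>x. oct_cnj ?u \<odot> x" "\<lambda>x. x \<odot> oct_cnj ?u"])
      (simp_all add: oct_linear_def oct_mult_distrib oct_mult_scale map_vec_oct[OF pc]
        oct_norm_mult u' tri)
qed

text \<open>With trace 0 the conjugate of u is -u, so the Moufang identity applies to the middle
  factor. The triple is only a similitude: norms are multiplied by N(u), N(u)^2, N(u). Two such
  triples with N(u) N(v) = 1 are composed so that all factors cancel.\<close>

lemma oct_trace_spin:
  assumes u: "oct_trace u = 0"
  shows "oct_trace ((x \<odot> oct_cnj u) \<odot> (((u \<odot> y) \<odot> oct_cnj u) \<odot> (u \<odot> z))) = (oct_norm u)\<^sup>2 *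
    oct_trace (x \<odot> (y \<odot> z))"
proof -
  have c: "oct_cnj u = - u" using u by (simp add: oct_cnj_eq)
  have "((u \<odot> y) \<odot> oct_cnj u) \<odot> (u \<odot> z) = u \<odot> (y \<odot> (oct_cnj u \<odot> (u \<odot> z)))"
    by (simp add: c oct_mult_minus oct_moufang)
  also have "\<dots> = oct_norm u *s (u \<odot> (y \<odot> z))"
    by (simp only: oct_cnj_mult_cancel oct_mult_scale)
  finally have "oct_trace ((x \<odot> oct_cnj u) \<odot> (((u \<odot> y) \<odot> oct_cnj u) \<odot> (u \<odot> z)))
     = oct_norm u * oct_trace (((x \<odot> oct_cnj u) \<odot> u) \<odot> (y \<odot> z))"
    by (simp only: oct_mult_scale oct_trace_linear oct_trace_assoc)
  then show ?thesis
    by (simp add: oct_cnj_mult_cancel oct_mult_scale oct_trace_linear power2_eq_square)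
qed

lemma herm_map_spin_SE6:
  fixes u v :: "'a::field oct"
  assumes u: "oct_trace u = 0" "oct_trace v = 0" "oct_norm u * oct_norm v = 1"
  shows "herm_map (\<lambda>x. (x \<odot> oct_cnj v) \<odot> oct_cnj u) (\<lambda>x. (u \<odot> ((v \<odot> x) \<odot> oct_cnj v)) \<odot> oct_cnj u)
    (\<lambda>x. u \<odot> (v \<odot> x)) \<in> SE6_carrier"
proof -
  note pc = ring_map_poly_const[where 'a = 'a]
  let ?u = "map_vec poly_const u" and ?v = "map_vec poly_const v"
  have t: "oct_trace ?u = 0" "oct_trace ?v = 0" "oct_norm ?u * oct_norm ?v = 1"
    using u by (simp_all flip: map_vec_oct[OF pc] ring_map_simps(3)[OF pc] add:
      ring_map_simps(1,4)[OF pc])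
  have *: "a * (b * r * b) * a = r" "r * b * a = r" "a * (b * r) = r" "a ^ 2 * (b ^ 2 * r) = r"
    if "a * b = 1" for a b r :: "'a jpoly"
  proof -
    have "a * (b * r * b) * a = (a * b) ^ 2 * r" "r * b * a = (a * b) * r" "a * (b * r) = (a * b) * r"
      "a ^ 2 * (b ^ 2 * r) = (a * b) ^ 2 * r"
      by (simp_all add: power2_eq_square mult_ac)
    then show "a * (b * r * b) * a = r" "r * b * a = r" "a * (b * r) = r" "a ^ 2 * (b ^ 2 * r) = r"
      using that by simp_all
  qed
  have norm: "oct_norm ((x \<odot> oct_cnj ?v) \<odot> oct_cnj ?u) = oct_norm x"
    "oct_norm ((?u \<odot> ((?v \<odot> x) \<odot> oct_cnj ?v)) \<odot> oct_cnj ?u) = oct_norm x"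
    "oct_norm (?u \<odot> (?v \<odot> x)) = oct_norm x" for x
    by (simp_all only: oct_norm_mult oct_cnj_simps *[OF t(3)])
  have tri: "oct_trace (((x \<odot> oct_cnj ?v) \<odot> oct_cnj ?u) \<odot>
      (((?u \<odot> ((?v \<odot> y) \<odot> oct_cnj ?v)) \<odot> oct_cnj ?u) \<odot> (?u \<odot> (?v \<odot> z))))
    = oct_trace (x \<odot> (y \<odot> z))" for x y z
    by (simp only: oct_trace_spin t *[OF t(3)])
  show ?thesis
    by (rule herm_map_SE6[of _ _ _ "\<lambda>x. (x \<odot> oct_cnj ?v) \<odot> oct_cnj ?u"
          "\<lambda>x. (?u \<odot> ((?v \<odot> x) \<odot> oct_cnj ?v)) \<odot> oct_cnj ?u" "\<lambda>x. ?u \<odot> (?v \<odot> x)"])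
      (simp_all only: norm tri oct_linear_def oct_mult_distrib oct_mult_scale map_vec_oct[OF pc]
        simp_thms)
qed

section \<open>Automorphisms in the coordinates of Zorn's vector matrices\<close>

definition oct8 :: "'a \<Rightarrow> 'a \<Rightarrow> 'a \<Rightarrow> 'a \<Rightarrow> 'a \<Rightarrow> 'a \<Rightarrow> 'a \<Rightarrow> 'a \<Rightarrow> 'a oct" where
  "oct8 a d p1 p2 p3 n1 n2 n3 = (\<chi> i. case i of
     Pos j \<Rightarrow> (case j of I0 \<Rightarrow> a | I1 \<Rightarrow> p1 | I\<omega> \<Rightarrow> p2 | I\<omega>bar \<Rightarrow> p3)
   | Neg j \<Rightarrow> (case j of I0 \<Rightarrow> d | I1 \<Rightarrow> n1 | I\<omega> \<Rightarrow> n2 | I\<omega>bar \<Rightarrow> n3))"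

lemma oct8_nth [simp]:
  "oct8 a d p1 p2 p3 n1 n2 n3 $ Pos I0 = a" "oct8 a d p1 p2 p3 n1 n2 n3 $ Neg I0 = d"
  "oct8 a d p1 p2 p3 n1 n2 n3 $ Pos I1 = p1" "oct8 a d p1 p2 p3 n1 n2 n3 $ Pos I\<omega> = p2"
  "oct8 a d p1 p2 p3 n1 n2 n3 $ Pos I\<omega>bar = p3" "oct8 a d p1 p2 p3 n1 n2 n3 $ Neg I1 = n1"
  "oct8 a d p1 p2 p3 n1 n2 n3 $ Neg I\<omega> = n2" "oct8 a d p1 p2 p3 n1 n2 n3 $ Neg I\<omega>bar = n3"
  by (simp_all add: oct8_def)

text \<open>The exponential of the derivation with \<open>e\<^sub>0 \<mapsto> p\<close>, where \<open>p\<close> is in the span of the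
  \<open>e\<^sub>i\<close> with \<open>i \<in> {1, \<omega>, \<omega>\<^sup>2}\<close>.\<close>

definition oct_exp :: "'a::comm_ring_1 \<Rightarrow> 'a \<Rightarrow> 'a \<Rightarrow> 'a oct \<Rightarrow> 'a oct" where
  "oct_exp p1 p2 p3 x =
    (let s = p1 * x $ Neg I1 + p2 * x $ Neg I\<omega> + p3 * x $ Neg I\<omega>bar; r = x $ Pos I0 - x $ Neg I0 + s in
     oct8 (x $ Pos I0 + s) (x $ Neg I0 - s)
      (x $ Pos I1 + r * p1) (x $ Pos I\<omega> + r * p2) (x $ Pos I\<omega>bar + r * p3)
      (x $ Neg I1 + x $ Pos I\<omega> * p3 - x $ Pos I\<omega>bar * p2)
      (x $ Neg I\<omega> + x $ Pos I\<omega>bar * p1 - x $ Pos I1 * p3)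
      (x $ Neg I\<omega>bar + x $ Pos I1 * p2 - x $ Pos I\<omega> * p1))"

definition oct_neg :: "'a::comm_ring_1 oct \<Rightarrow> 'a oct" where
  "oct_neg x = oct8 (x $ Neg I0) (x $ Pos I0) (x $ Neg I1) (x $ Neg I\<omega>) (x $ Neg I\<omega>bar)
     (x $ Pos I1) (x $ Pos I\<omega>) (x $ Pos I\<omega>bar)"

definition oct_rot :: "'a::comm_ring_1 oct \<Rightarrow> 'a oct" where
  "oct_rot x = oct8 (x $ Pos I0) (x $ Neg I0) (x $ Pos I\<omega>bar) (x $ Pos I1) (x $ Pos I\<omega>)
     (x $ Neg I\<omega>bar) (x $ Neg I1) (x $ Neg I\<omega>)"

text \<open>A transvection on the positive coordinates and its contragredient on the negative ones,
  so that the pairing p.n and the cross products in the multiplication are respected.\<close>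

definition oct_trans12 :: "'a::comm_ring_1 \<Rightarrow> 'a oct \<Rightarrow> 'a oct" where
  "oct_trans12 t x = oct8 (x $ Pos I0) (x $ Neg I0) (x $ Pos I1 + t * x $ Pos I\<omega>) (x $ Pos I\<omega>) (x
    $ Pos I\<omega>bar)
     (x $ Neg I1) (x $ Neg I\<omega> - t * x $ Neg I1) (x $ Neg I\<omega>bar)"

definition oct_trans21 :: "'a::comm_ring_1 \<Rightarrow> 'a oct \<Rightarrow> 'a oct" where
  "oct_trans21 t x = oct8 (x $ Pos I0) (x $ Neg I0) (x $ Pos I1) (x $ Pos I\<omega> + t * x $ Pos I1) (x
    $ Pos I\<omega>bar)
     (x $ Neg I1 - t * x $ Neg I\<omega>) (x $ Neg I\<omega>) (x $ Neg I\<omega>bar)"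

lemmas oct_auto_defs = oct_exp_def oct_neg_def oct_rot_def oct_trans12_def oct_trans21_def Let_def

definition oct_automorphism :: "('a::comm_ring_1 oct \<Rightarrow> 'a oct) \<Rightarrow> bool" where
  "oct_automorphism g \<longleftrightarrow> oct_linear g \<and> (\<forall>x y. g (x \<odot> y) = g x \<odot> g y) \<and>
     (\<forall>x. oct_norm (g x) = oct_norm x) \<and> (\<forall>x. oct_trace (g x) = oct_trace x)"

lemma oct_automorphism_exp: "oct_automorphism (oct_exp p1 p2 p3)"
  by (simp add: oct_automorphism_def oct_linear_def oct_simps oct_auto_defs algebra_simps)

lemma oct_automorphism_trans: "oct_automorphism (oct_trans12 t)" "oct_automorphism (oct_trans21 t)"
  by (simp_all add: oct_automorphism_def oct_linear_def oct_simps oct_auto_defs algebra_simps)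

lemma oct_automorphism_perm: "oct_automorphism oct_neg" "oct_automorphism oct_rot"
  by (simp_all add: oct_automorphism_def oct_linear_def oct_simps oct_auto_defs algebra_simps)

lemma map_vec_oct_auto:
  assumes "ring_map h"
  shows "oct_exp (h p1) (h p2) (h p3) (map_vec h x) = map_vec h (oct_exp p1 p2 p3 x)"
    "oct_trans12 (h t) (map_vec h x) = map_vec h (oct_trans12 t x)"
    "oct_trans21 (h t) (map_vec h x) = map_vec h (oct_trans21 t x)"
    "oct_neg (map_vec h x) = map_vec h (oct_neg x)" "oct_rot (map_vec h x) = map_vec h (oct_rot x)"
  by (simp_all add: oct_simps oct_auto_defs ring_map_simps[OF assms])

lemma herm_map_auto_SE6:
  assumes "oct_automorphism g" "oct_automorphism g'"
    and ext: "\<And>x. g' (map_vec poly_const x) = map_vec poly_const (g x)"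
  shows "herm_map g g g \<in> SE6_carrier"
  using assms unfolding oct_automorphism_def
  by (intro herm_map_SE6[of _ _ _ g' g' g']) metis+

lemma herm_map_oct_auto_SE6:
  "herm_map (oct_exp p1 p2 p3) (oct_exp p1 p2 p3) (oct_exp p1 p2 p3) \<in> SE6_carrier"
  "herm_map (oct_trans12 t) (oct_trans12 t) (oct_trans12 t) \<in> SE6_carrier"
  "herm_map (oct_trans21 t) (oct_trans21 t) (oct_trans21 t) \<in> SE6_carrier"
  "herm_map oct_neg oct_neg oct_neg \<in> SE6_carrier"
  "herm_map oct_rot oct_rot oct_rot \<in> SE6_carrier"
  by (rule herm_map_auto_SE6[OF oct_automorphism_exp oct_automorphism_exp map_vec_oct_auto(1)]
      herm_map_auto_SE6[OF oct_automorphism_trans(1) oct_automorphism_trans(1) map_vec_oct_auto(2)]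
      herm_map_auto_SE6[OF oct_automorphism_trans(2) oct_automorphism_trans(2) map_vec_oct_auto(3)]
      herm_map_auto_SE6[OF oct_automorphism_perm(1) oct_automorphism_perm(1) map_vec_oct_auto(4)]
      herm_map_auto_SE6[OF oct_automorphism_perm(2) oct_automorphism_perm(2) map_vec_oct_auto(5)];
      rule ring_map_poly_const)+

section \<open>Stabilizers of a frame of white vectors\<close>

text \<open>These are the coordinates of the quadratic adjoint of x, set equal to 0; the zero vector
  satisfies them too.\<close>

definition rank_one :: "'a::comm_ring_1 herm \<Rightarrow> bool" where
  "rank_one x \<longleftrightarrow> x $ Jb * x $ Jc = oct_norm (octA x) \<and> x $ Jc * x $ Ja = oct_norm (octB x) \<and>
     x $ Ja * x $ Jb = oct_norm (octC x) \<and> octB x \<odot> octC x = x $ Ja *s oct_cnj (octA x) \<and>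
     octC x \<odot> octA x = x $ Jb *s oct_cnj (octB x) \<and> octA x \<odot> octB x = x $ Jc *s oct_cnj (octC x)"

text \<open>Each equation is the polar form tested on one coordinate subspace, and nondegeneracy of
  \<open>oct_bil\<close> turns a pairing with all z into an equation of octonions. This makes the
  coordinate condition invariant under the group.\<close>

lemma rank_one_iff_polar: "rank_one x \<longleftrightarrow> (\<forall>y. det_polar x y = 0)"
proof (cases x rule: herm_cases)
  case (1 a b c A B C)
  have tr: "oct_trace (A \<odot> (z \<odot> C)) = oct_trace (z \<odot> (C \<odot> A))"
     "oct_trace (A \<odot> (B \<odot> z)) = oct_trace (z \<odot> (A \<odot> B))" for z
    by (metis oct_trace_commute oct_trace_assoc)+
  show ?thesis
  proof
    assume r: "rank_one x"
    then have "B \<odot> C = a *s oct_cnj A" "C \<odot> A = b *s oct_cnj B" "A \<odot> B = c *s oct_cnj C"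
      by (simp_all add: 1 rank_one_def)
    then have "oct_trace (z \<odot> (B \<odot> C)) = a * oct_bil A z" "oct_trace (A \<odot> (z \<odot> C)) = b * oct_bil B z"
       "oct_trace (A \<odot> (B \<odot> z)) = c * oct_bil C z" for z
      by (simp_all add: tr) (simp_all add: oct_trace_mult oct_bil_linear oct_cnj_linear oct_bil_commute)
    with r show "\<forall>y. det_polar x y = 0"
      by (simp add: det_polar_def 1 rank_one_def)
  next
    assume p: "\<forall>y. det_polar x y = 0"
    have eqI: "u = r *s oct_cnj v" if "\<And>z. oct_trace (z \<odot> u) = r * oct_bil v z" for u v r
    proof -
      have "oct_bil (oct_cnj u) z = oct_bil (r *s v) z" for z
        using that[of z] by (simp add: oct_trace_mult oct_bil_linear oct_bil_commute)
      then have "oct_cnj u = r *s v" by (rule oct_bil_eqI)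
      then show ?thesis by (metis oct_cnj_linear(2) oct_cnj_simps(1))
    qed
    have "B \<odot> C = a *s oct_cnj A"
      by (rule eqI) (use p[rule_format, of "herm 0 0 0 _ 0 0"] in \<open>simp add: det_polar_def 1 oct_simps\<close>)
    moreover have "C \<odot> A = b *s oct_cnj B"
    proof (rule eqI)
      show "oct_trace (z \<odot> (C \<odot> A)) = b * oct_bil B z" for z
        using p[rule_format, of "herm 0 0 0 0 z 0"] by (simp add: det_polar_def 1 tr)
    qed
    moreover have "A \<odot> B = c *s oct_cnj C"
    proof (rule eqI)
      show "oct_trace (z \<odot> (A \<odot> B)) = c * oct_bil C z" for z
        using p[rule_format, of "herm 0 0 0 0 0 z"] by (simp add: det_polar_def 1 tr)
    qed
    ultimately show "rank_one x"
      using p[rule_format, of "herm 1 0 0 0 0 0"] p[rule_format, of "herm 0 1 0 0 0 0"]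
        p[rule_format, of "herm 0 0 1 0 0 0"]
      by (simp add: 1 rank_one_def det_polar_def)
  qed
qed

lemma SE6_surj: "f \<in> SE6_carrier \<Longrightarrow> surj (f :: 'a::{field,finite} herm \<Rightarrow> _)"
  by (simp add: SE6_inj finite_UNIV_inj_surj)

lemma SE6_rank_one:
  assumes "f \<in> SE6_carrier"
  shows "rank_one (f x) \<longleftrightarrow> rank_one (x :: 'a::{field,finite} herm)"
  unfolding rank_one_iff_polar using SE6_polar[OF assms] SE6_surj[OF assms] by (metis surjD)

lemma SE6_tri_zero_iff:
  assumes "f \<in> SE6_carrier"
  shows "(\<forall>z. det_tri (f x) (f y) z = 0) \<longleftrightarrow> (\<forall>z. det_tri x y (z :: 'a::{field,finite} herm) = 0)"
  using SE6_tri[OF assms] SE6_surj[OF assms] by (metis surjD)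

lemma SE6_eq_0_iff: "f \<in> SE6_carrier \<Longrightarrow> f x = 0 \<longleftrightarrow> x = 0"
  by (metis SE6_inj SE6_linear(3) injD)

lemma perm_group_reach:
  "perm_group H \<Longrightarrow> f \<in> H \<Longrightarrow> \<exists>g\<in>H. g (f x) = v \<Longrightarrow> \<exists>g\<in>H. g x = v"
  by (metis perm_group_comp comp_apply)

definition herm_a :: "'a::comm_ring_1 herm" where "herm_a = herm 1 0 0 0 0 0"
definition herm_b :: "'a::comm_ring_1 herm" where "herm_b = herm 0 1 0 0 0 0"
definition herm_c :: "'a::comm_ring_1 herm" where "herm_c = herm 0 0 1 0 0 0"

lemmas herm_frame_defs = herm_a_def herm_b_def herm_c_def

abbreviation SE6_c :: "('a::{field,finite} herm \<Rightarrow> 'a herm) set" where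
  "SE6_c \<equiv> stabilizer SE6_carrier herm_c"
abbreviation SE6_bc :: "('a::{field,finite} herm \<Rightarrow> 'a herm) set" where
  "SE6_bc \<equiv> stabilizer SE6_c herm_b"
abbreviation SE6_abc :: "('a::{field,finite} herm \<Rightarrow> 'a herm) set" where
  "SE6_abc \<equiv> stabilizer SE6_bc herm_a"

text \<open>Conjugates of the basic shears by the rotation, whose square is its inverse. They alter
  only entries in the third row and column and therefore fix \<open>herm_c\<close>.\<close>

definition shear32 :: "'a::comm_ring_1 oct \<Rightarrow> 'a herm \<Rightarrow> 'a herm" where
  "shear32 X = rotate_herm \<circ> rotate_herm \<circ> shear21 X \<circ> rotate_herm"

definition shear31 :: "'a::comm_ring_1 oct \<Rightarrow> 'a herm \<Rightarrow> 'a herm" where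
  "shear31 X = rotate_herm \<circ> shear12 X \<circ> rotate_herm \<circ> rotate_herm"

lemma shear32_eq: "shear32 X x = herm (x $ Ja) (x $ Jb) (x $ Jc + oct_bil X (octA x) + oct_norm X
  * x $ Jb)
    (octA x + x $ Jb *s X) (octB x + oct_cnj (octC x \<odot> X)) (octC x)"
  by (simp add: shear32_def rotate_herm_def shear21_def)

lemma shear31_eq: "shear31 X x = herm (x $ Ja) (x $ Jb) (x $ Jc + oct_bil X (octB x) + oct_norm X
  * x $ Ja)
    (octA x + oct_cnj (X \<odot> octC x)) (octB x + x $ Ja *s X) (octC x)"
  by (simp add: shear31_def rotate_herm_def shear12_def)

lemma shear_SE6_c: "shear12 X \<in> SE6_c" "shear21 X \<in> SE6_c" "shear32 X \<in> SE6_c" "shear31 X \<in> SE6_c"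
proof -
  show "shear12 X \<in> SE6_c" "shear21 X \<in> SE6_c"
    by (simp_all add: stabilizer_def shear12_SE6 shear21_SE6 shear12_def shear21_def herm_frame_defs)
  have "shear32 X \<in> SE6_carrier" "shear31 X \<in> SE6_carrier"
    unfolding shear32_def shear31_def by (intro SE6_comp shear12_SE6 shear21_SE6 rotate_herm_SE6)+
  then show "shear32 X \<in> SE6_c" "shear31 X \<in> SE6_c"
    by (simp_all add: stabilizer_def shear32_eq shear31_eq herm_frame_defs)
qed

lemma shear_SE6_bc: "shear21 X \<in> SE6_bc" "shear31 X \<in> SE6_bc"
  using shear_SE6_c[of X]
  by (simp_all add: stabilizer_def[of SE6_c] shear21_def shear31_eq) (simp_all add: herm_frame_defs)

lemmas perm_group_frame = perm_group_SE6 perm_group_stabilizer[OF perm_group_SE6]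
  perm_group_stabilizer[OF perm_group_stabilizer[OF perm_group_SE6]]
  perm_group_stabilizer[OF perm_group_stabilizer[OF perm_group_stabilizer[OF perm_group_SE6]]]

definition white :: "'a::comm_ring_1 herm set" where
  "white = {x. x \<noteq> 0 \<and> rank_one x}"

text \<open>The side condition says that \<open>det_tri herm_c x\<close> is not identically zero,
  which is visibly stable under the stabilizer of \<open>herm_c\<close>.\<close>

definition white_c :: "'a::comm_ring_1 herm set" where
  "white_c = {x. rank_one x \<and> (x $ Ja \<noteq> 0 \<or> x $ Jb \<noteq> 0 \<or> octC x \<noteq> 0)}"

text \<open>The coordinate a is \<open>det_tri herm_c herm_b x\<close>, hence an invariant once
  \<open>herm_c\<close> and \<open>herm_b\<close> are fixed.\<close>

definition white_bc :: "'a::comm_ring_1 herm set" where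
  "white_bc = {x. rank_one x \<and> x $ Ja = 1}"

lemma SE6_c_rank_one: "f \<in> SE6_c \<Longrightarrow> rank_one (f x) \<longleftrightarrow> rank_one x"
  by (simp add: stabilizer_def SE6_rank_one)

text \<open>Rank one gives b = N(C)/a, which the shear changes to N(C + aX)/a. The choice of X makes
  C + aX equal to aZ with N(Z) = 1/a.\<close>

lemma shear21_to_one:
  fixes x :: "'a::{field,finite} herm"
  assumes "rank_one x" "x $ Ja \<noteq> 0"
  shows "\<exists>X. shear21 X x $ Jb = 1"
proof -
  let ?a = "x $ Ja" and ?C = "octC x"
  obtain Z :: "'a oct" where Z: "oct_norm Z = 1 / ?a" using oct_norm_surj by blast
  have b: "x $ Jb = oct_norm ?C / ?a" using assms by (simp add: rank_one_def field_simps)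
  have "shear21 (Z - (1 / ?a) *s ?C) x $ Jb = 1"
    using assms(2)
    by (simp add: shear21_def b Z oct_norm_add[of Z "- ((1 / ?a) *s ?C)", simplified]
      oct_bil_linear oct_norm_scale
      oct_bil_self field_simps power2_eq_square)
  then show ?thesis by blast
qed

text \<open>The entry b must become exactly 1, which \<open>shear21\<close> achieves once a or C is
  nonzero. If b is the only nonzero one of the three, \<open>shear12 oct_one\<close> first copies it
  to a.\<close>

lemma SE6_c_to_one:
  fixes x :: "'a::{field,finite} herm"
  assumes "x \<in> white_c" shows "\<exists>f\<in>SE6_c. f x $ Jb = 1"
proof -
  have r: "rank_one x" using assms by (simp add: white_c_def)
  consider "x $ Ja \<noteq> 0" | "x $ Ja = 0" "octC x \<noteq> 0" | "x $ Ja = 0" "octC x = 0" "x $ Jb \<noteq> 0"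
    using assms by (auto simp: white_c_def)
  then show ?thesis
  proof cases
    case 1
    then show ?thesis using shear21_to_one[OF r] shear_SE6_c(2) by blast
  next
    case 2
    then obtain X where "oct_bil X (octC x) = 1 - x $ Jb" using oct_bil_surj by blast
    then have "shear21 X x $ Jb = 1" using 2 by (simp add: shear21_def)
    then show ?thesis using shear_SE6_c(2) by blast
  next
    case 3
    let ?y = "shear12 oct_one x"
    have "?y $ Ja \<noteq> 0" using 3 by (simp add: shear12_def)
    moreover have "rank_one ?y" using r shear_SE6_c(1) SE6_c_rank_one by blast
    ultimately obtain X where "shear21 X ?y $ Jb = 1" using shear21_to_one by blast
    then have "(shear21 X \<circ> shear12 oct_one) x $ Jb = 1" by simp
    moreover have "shear21 X \<circ> shear12 oct_one \<in> SE6_c"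
      by (intro perm_group_comp perm_group_frame shear_SE6_c)
    ultimately show ?thesis by blast
  qed
qed

text \<open>Once b = 1, shears clear C and A, and the rank-one equations determine the rest: a =
  N(C), c = N(A), and B is the conjugate of CA.\<close>

lemma SE6_c_transitive:
  fixes x :: "'a::{field,finite} herm"
  assumes "x \<in> white_c" shows "\<exists>f\<in>SE6_c. f x = herm_b"
proof -
  note pg = perm_group_frame(2)[of herm_c]
  obtain f where f: "f \<in> SE6_c" "f x $ Jb = 1" using SE6_c_to_one[OF assms] by blast
  define y where "y = shear12 (- octC (f x)) (f x)"
  define z where "z = shear32 (- octA y) y"
  have "rank_one (f x)" using assms f(1) SE6_c_rank_one by (auto simp: white_c_def)
  then have "rank_one y" using shear_SE6_c(1) SE6_c_rank_one y_def by blast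
  then have "rank_one z" using shear_SE6_c(3) SE6_c_rank_one z_def by blast
  have y: "y $ Jb = 1" "octC y = 0" by (simp_all add: y_def shear12_def f)
  have z: "z $ Jb = 1" "octC z = 0" "octA z = 0" by (simp_all add: z_def shear32_eq y)
  have "z = herm_b"
    by (rule herm_eqI)
      (use \<open>rank_one z\<close> in \<open>simp_all add: herm_b_def z rank_one_def\<close>, metis oct_cnj_simps(1,2))
  then have "\<exists>g\<in>SE6_c. g z = herm_b" using pg by (metis id_apply perm_group_def)
  then have "\<exists>g\<in>SE6_c. g y = herm_b" unfolding z_def by (rule perm_group_reach[OF pg shear_SE6_c(3)])
  then have "\<exists>g\<in>SE6_c. g (f x) = herm_b" unfolding y_def by (rule perm_group_reach[OF pg shear_SE6_c(1)])
  then show ?thesis by (rule perm_group_reach[OF pg f(1)])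
qed

lemma SE6_bc_transitive:
  fixes x :: "'a::{field,finite} herm"
  assumes "x \<in> white_bc" shows "\<exists>f\<in>SE6_bc. f x = herm_a"
proof -
  note pg = perm_group_frame(3)[of herm_c herm_b]
  define y where "y = shear21 (- octC x) x"
  define z where "z = shear31 (- octB y) y"
  have x: "rank_one x" "x $ Ja = 1" using assms by (auto simp: white_bc_def)
  then have "rank_one y" using shear_SE6_c(2) SE6_c_rank_one y_def by blast
  then have "rank_one z" using shear_SE6_c(4) SE6_c_rank_one z_def by blast
  have y: "y $ Ja = 1" "octC y = 0" by (simp_all add: y_def shear21_def x)
  have z: "z $ Ja = 1" "octC z = 0" "octB z = 0" by (simp_all add: z_def shear31_eq y)
  have "z = herm_a"
    by (rule herm_eqI)
      (use \<open>rank_one z\<close> in \<open>simp_all add: herm_a_def z rank_one_def\<close>, metis oct_cnj_simps(1,2))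
  then have "\<exists>g\<in>SE6_bc. g z = herm_a" using pg by (metis id_apply perm_group_def)
  then have "\<exists>g\<in>SE6_bc. g y = herm_a" unfolding z_def by (rule perm_group_reach[OF pg shear_SE6_bc(2)])
  then show ?thesis unfolding y_def by (rule perm_group_reach[OF pg shear_SE6_bc(1)])
qed

text \<open>Some rotation of a nonzero x has a nonzero entry among a, b, C. The reduction then ends
  at \<open>herm_b\<close>, which two further rotations carry to \<open>herm_c\<close>.\<close>

lemma SE6_transitive:
  fixes x :: "'a::{field,finite} herm"
  assumes x: "x \<in> white" shows "\<exists>f\<in>SE6_carrier. f x = herm_c"
proof -
  note pg = perm_group_frame(1)
  note R = rotate_herm_SE6
  have *: "\<exists>f\<in>SE6_carrier. f y = herm_c" if y: "y \<in> white_c" for y :: "'a herm"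
  proof -
    obtain f where f: "f \<in> SE6_c" "f y = herm_b" using SE6_c_transitive[OF y] by blast
    then have "(rotate_herm \<circ> rotate_herm \<circ> f) y = herm_c"
      by (simp add: rotate_herm_def herm_b_def herm_c_def)
    moreover have "rotate_herm \<circ> rotate_herm \<circ> f \<in> SE6_carrier"
      using f by (intro SE6_comp R) (simp add: stabilizer_def)
    ultimately show ?thesis by blast
  qed
  have r: "rank_one x" "rank_one (rotate_herm x)" "rank_one (rotate_herm (rotate_herm x))"
    using x by (simp_all add: white_def SE6_rank_one R)
  have "x \<noteq> 0" using x by (simp add: white_def)
  then have "\<not> (x $ Ja = 0 \<and> x $ Jb = 0 \<and> x $ Jc = 0 \<and> octA x = 0 \<and> octB x = 0 \<and> octC x = 0)"
    by (metis herm_eta herm_zero)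
  then consider "x \<in> white_c" | "rotate_herm x \<in> white_c" | "rotate_herm (rotate_herm x) \<in> white_c"
    using r by (auto simp: white_c_def rotate_herm_def)
  then show ?thesis
    by cases (use * perm_group_reach[OF pg R] in blast)+
qed

text \<open>This and the two lemmas that follow recover coordinate subspaces from the frame vectors
  alone, so that maps fixing those vectors must preserve the subspaces.\<close>

lemma det_tri_c_zero_iff: "(\<forall>z. det_tri herm_c x z = 0) \<longleftrightarrow> x $ Ja = 0 \<and> x $ Jb = 0 \<and> octC x = 0"
proof (cases x rule: herm_cases)
  case (1 a b c A B C)
  have e: "det_tri herm_c x (herm a' b' c' A' B' C') = a' * b + b' * a - oct_bil C C'" for a' b'
    c' A' B' C'
    by (simp add: 1 herm_c_def det_tri_herm)
  show ?thesis
  proof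
    assume *: "\<forall>z. det_tri herm_c x z = 0"
    have "oct_bil C z = 0" for z
      using *[rule_format, of "herm 0 0 0 0 0 z"] by (simp add: e)
    then have "C = 0" by (rule oct_bil_nondegenerate)
    then show "x $ Ja = 0 \<and> x $ Jb = 0 \<and> octC x = 0"
      using *[rule_format, of "herm 1 0 0 0 0 0"] *[rule_format, of "herm 0 1 0 0 0 0"]
      by (simp add: e) (simp add: 1)
  next
    assume "x $ Ja = 0 \<and> x $ Jb = 0 \<and> octC x = 0"
    then show "\<forall>z. det_tri herm_c x z = 0"
      by (metis (no_types) 1 e herm_cases herm_nth add_0 diff_self mult_zero_right oct_bil_simps(1))
  qed
qed

lemma det_tri_a_zero_iff: "(\<forall>z. det_tri herm_a x z = 0) \<longleftrightarrow> x $ Jb = 0 \<and> x $ Jc = 0 \<and> octA x = 0"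
proof (cases x rule: herm_cases)
  case (1 a b c A B C)
  have e: "det_tri herm_a x (herm a' b' c' A' B' C') = b' * c + c' * b - oct_bil A A'" for a' b'
    c' A' B' C'
    by (simp add: 1 herm_a_def det_tri_herm)
  show ?thesis
  proof
    assume *: "\<forall>z. det_tri herm_a x z = 0"
    have "oct_bil A z = 0" for z
      using *[rule_format, of "herm 0 0 0 z 0 0"] by (simp add: e)
    then have "A = 0" by (rule oct_bil_nondegenerate)
    then show "x $ Jb = 0 \<and> x $ Jc = 0 \<and> octA x = 0"
      using *[rule_format, of "herm 0 1 0 0 0 0"] *[rule_format, of "herm 0 0 1 0 0 0"]
      by (simp add: e) (simp add: 1)
  next
    assume "x $ Jb = 0 \<and> x $ Jc = 0 \<and> octA x = 0"
    then show "\<forall>z. det_tri herm_a x z = 0"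
      by (metis (no_types) 1 e herm_cases herm_nth add_0 diff_self mult_zero_right oct_bil_simps(1))
  qed
qed

lemma det_tri_b_zero_iff: "(\<forall>z. det_tri herm_b x z = 0) \<longleftrightarrow> x $ Jc = 0 \<and> x $ Ja = 0 \<and> octB x = 0"
proof (cases x rule: herm_cases)
  case (1 a b c A B C)
  have e: "det_tri herm_b x (herm a' b' c' A' B' C') = a' * c + c' * a - oct_bil B B'" for a' b'
    c' A' B' C'
    by (simp add: 1 herm_b_def det_tri_herm)
  show ?thesis
  proof
    assume *: "\<forall>z. det_tri herm_b x z = 0"
    have "oct_bil B z = 0" for z
      using *[rule_format, of "herm 0 0 0 0 z 0"] by (simp add: e)
    then have "B = 0" by (rule oct_bil_nondegenerate)
    then show "x $ Jc = 0 \<and> x $ Ja = 0 \<and> octB x = 0"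
      using *[rule_format, of "herm 1 0 0 0 0 0"] *[rule_format, of "herm 0 0 1 0 0 0"]
      by (simp add: e) (simp add: 1)
  next
    assume "x $ Jc = 0 \<and> x $ Ja = 0 \<and> octB x = 0"
    then show "\<forall>z. det_tri herm_b x z = 0"
      by (metis (no_types) 1 e herm_cases herm_nth add_0 diff_self mult_zero_right oct_bil_simps(1))
  qed
qed

lemma herm_frame_white: "herm_c \<in> (white :: 'a::field herm set)" "herm_b \<in> (white_c :: 'a::field
  herm set)"
  "herm_a \<in> (white_bc :: 'a::field herm set)"
proof -
  have "herm_c \<noteq> (0 :: 'a herm)" by (simp add: herm_c_def flip: herm_zero)
  then show "herm_c \<in> (white :: 'a herm set)" "herm_b \<in> (white_c :: 'a herm set)" "herm_a \<in>
    (white_bc :: 'a herm set)"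
    by (simp_all add: white_def white_c_def white_bc_def rank_one_def herm_frame_defs)
qed

lemma SE6_c_white_c:
  assumes f: "f \<in> SE6_c" and x: "x \<in> white_c" shows "f x \<in> white_c"
proof -
  have f': "f \<in> SE6_carrier" "f herm_c = herm_c" using f by (auto simp: stabilizer_def)
  show ?thesis
    using x SE6_tri_zero_iff[OF f'(1), of herm_c x] SE6_rank_one[OF f'(1), of x]
    by (auto simp: f'(2) white_c_def det_tri_c_zero_iff)
qed

lemma SE6_bc_white_bc:
  assumes f: "f \<in> SE6_bc" and x: "x \<in> white_bc" shows "f x \<in> white_bc"
proof -
  have f': "f \<in> SE6_carrier" "f herm_c = herm_c" "f herm_b = herm_b" using f
    by (auto simp: stabilizer_def)
  have "det_tri herm_c herm_b y = y $ Ja" for y :: "'a herm"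
    by (cases y rule: herm_cases) (simp add: det_tri_herm herm_frame_defs)
  then show ?thesis
    using x SE6_tri[OF f'(1), of herm_c herm_b x] SE6_rank_one[OF f'(1), of x]
    by (simp add: f'(2,3) white_bc_def)
qed

lemma card_SE6_frame:
  "card (SE6_carrier :: ('a::{field,finite} herm \<Rightarrow> _) set)
    = card (white :: 'a herm set) * (card (white_c :: 'a herm set) *
      (card (white_bc :: 'a herm set) * card (SE6_abc :: ('a herm \<Rightarrow> _) set)))"
proof -
  have "f herm_c \<in> white" if "f \<in> SE6_carrier" for f :: "'a herm \<Rightarrow> _"
    using herm_frame_white(1) SE6_rank_one[OF that] SE6_eq_0_iff[OF that] by (simp add: white_def)
  then have "card (SE6_carrier :: ('a herm \<Rightarrow> _) set) = card (white :: 'a herm set) * card (SE6_c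
    :: ('a herm \<Rightarrow> _) set)"
    by (intro card_orbit_stabilizer[OF perm_group_frame(1) _ SE6_transitive finite])
  also have "card (SE6_c :: ('a herm \<Rightarrow> _) set) = card (white_c :: 'a herm set) * card (SE6_bc ::
    ('a herm \<Rightarrow> _) set)"
    by (rule card_orbit_stabilizer[OF perm_group_frame(2) _ SE6_c_transitive finite])
      (simp_all add: SE6_c_white_c herm_frame_white)
  also have "card (SE6_bc :: ('a herm \<Rightarrow> _) set) = card (white_bc :: 'a herm set) * card (SE6_abc
    :: ('a herm \<Rightarrow> _) set)"
    by (rule card_orbit_stabilizer[OF perm_group_frame(3) _ SE6_bc_transitive finite])
      (simp_all add: SE6_bc_white_bc herm_frame_white)
  finally show ?thesis .
qed

section \<open>The stabilizer of the three diagonal idempotents\<close>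

lemma herm_map_SE6_D:
  assumes f: "herm_map \<alpha> \<beta> \<gamma> \<in> (SE6_carrier :: ('a::{field,finite} herm \<Rightarrow> _) set)"
  shows "oct_linear \<alpha>" "oct_linear \<beta>" "oct_linear \<gamma>"
    and "oct_norm (\<alpha> x) = oct_norm x" "oct_norm (\<beta> x) = oct_norm x" "oct_norm (\<gamma> x) = oct_norm x"
    and "oct_trace (\<alpha> x \<odot> (\<beta> y \<odot> \<gamma> z)) = oct_trace (x \<odot> (y \<odot> z))"
    and "surj \<alpha>" "surj \<beta>" "surj \<gamma>"
proof -
  note lin = SE6_linear(1,2)[OF f] and polar = SE6_polar[OF f]
  have "\<alpha> (x + y) = \<alpha> x + \<alpha> y" "\<beta> (x + y) = \<beta> x + \<beta> y" "\<gamma> (x + y) = \<gamma> x + \<gamma> y" for x y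
    using lin(1)[of "herm 0 0 0 x x x" "herm 0 0 0 y y y"] by (simp_all add: herm_map_def herm_add)
  moreover have "\<alpha> (c *s x) = c *s \<alpha> x" "\<beta> (c *s x) = c *s \<beta> x" "\<gamma> (c *s x) = c *s \<gamma> x" for c x
    using lin(2)[of c "herm 0 0 0 x x x"] by (simp_all add: herm_map_def herm_scale)
  ultimately show *: "oct_linear \<alpha>" "oct_linear \<beta>" "oct_linear \<gamma>"
    by (simp_all add: oct_linear_def)
  have z: "\<alpha> 0 = 0" "\<beta> 0 = 0" "\<gamma> 0 = 0"
    using SE6_linear(3)[OF f] by (simp_all add: herm_map_def flip: herm_zero)
  show "oct_norm (\<alpha> x) = oct_norm x" "oct_norm (\<beta> x) = oct_norm x" "oct_norm (\<gamma> x) = oct_norm x"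
    using polar[of "herm 0 0 0 x 0 0" "herm 1 0 0 0 0 0"] polar[of "herm 0 0 0 0 x 0" "herm 0 1 0 0 0 0"]
      polar[of "herm 0 0 0 0 0 x" "herm 0 0 1 0 0 0"]
    by (simp_all add: det_polar_def herm_map_def z)
  show "oct_trace (\<alpha> x \<odot> (\<beta> y \<odot> \<gamma> z)) = oct_trace (x \<odot> (y \<odot> z))"
    using SE6_tri[OF f, of "herm 0 0 0 x 0 0" "herm 0 0 0 0 y 0" "herm 0 0 0 0 0 z"]
    by (simp add: det_tri_herm herm_map_def z)
  have "\<exists>y. \<alpha> y = x" "\<exists>y. \<beta> y = x" "\<exists>y. \<gamma> y = x" for x
    using SE6_surj[OF f, THEN surjD, of "herm 0 0 0 x x x"] by (auto simp: herm_map_def)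
  then show "surj \<alpha>" "surj \<beta>" "surj \<gamma>" by (metis surjI)+
qed

text \<open>The A-space is the intersection of the kernels attached to \<open>herm_b\<close> and
  \<open>herm_c\<close>, and the B- and C-spaces arise likewise; hence f acts on each of the three
  separately.\<close>

lemma SE6_abc_herm_map:
  assumes f: "f \<in> (SE6_abc :: ('a::{field,finite} herm \<Rightarrow> _) set)"
  shows "\<exists>\<alpha> \<beta> \<gamma>. f = herm_map \<alpha> \<beta> \<gamma>"
proof -
  have f': "f \<in> SE6_carrier" "f herm_a = herm_a" "f herm_b = herm_b" "f herm_c = herm_c"
    using f by (auto simp: stabilizer_def)
  note lin = SE6_linear[OF f'(1)] and tz = SE6_tri_zero_iff[OF f'(1)]
  define \<alpha> \<beta> \<gamma> where "\<alpha> A = octA (f (herm 0 0 0 A 0 0))" and "\<beta> A = octB (f (herm 0 0 0 0 A 0))"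
    and "\<gamma> A = octC (f (herm 0 0 0 0 0 A))" for A
  note a = tz[of herm_a, unfolded f'(2) det_tri_a_zero_iff]
    and b = tz[of herm_b, unfolded f'(3) det_tri_b_zero_iff]
    and c = tz[of herm_c, unfolded f'(4) det_tri_c_zero_iff]
  have A: "f (herm 0 0 0 A 0 0) = herm 0 0 0 (\<alpha> A) 0 0" and B: "f (herm 0 0 0 0 A 0) = herm 0 0 0
    0 (\<beta> A) 0"
    and C: "f (herm 0 0 0 0 0 A) = herm 0 0 0 0 0 (\<gamma> A)" for A
    using b[of "herm 0 0 0 A 0 0"] c[of "herm 0 0 0 A 0 0"] a[of "herm 0 0 0 0 A 0"] c[of "herm 0
      0 0 0 A 0"]
      a[of "herm 0 0 0 0 0 A"] b[of "herm 0 0 0 0 0 A"]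
    by (auto intro!: herm_eqI simp: \<alpha>_def \<beta>_def \<gamma>_def)
  have "f x = herm_map \<alpha> \<beta> \<gamma> x" for x
  proof (cases x rule: herm_cases)
    case (1 a b c A B C)
    have "x = a *s herm_a + b *s herm_b + c *s herm_c + herm 0 0 0 A 0 0 + herm 0 0 0 0 B 0 + herm
      0 0 0 0 0 C"
      by (simp add: 1 herm_frame_defs herm_scale herm_add)
    then have "f x = a *s herm_a + b *s herm_b + c *s herm_c + herm 0 0 0 (\<alpha> A) 0 0 + herm 0 0 0 0
      (\<beta> B) 0 + herm 0 0 0 0 0 (\<gamma> C)"
      by (simp add: lin A B C f'(2-4))
    then show ?thesis
      by (simp add: 1 herm_frame_defs herm_scale herm_add herm_map_def)
  qed
  then show ?thesis by blast
qed

lemma oct_linear_zero: "oct_linear f \<Longrightarrow> f 0 = 0"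
  by (metis oct_linear_def vector_smult_lzero)

lemma herm_map_SE6_abc:
  assumes "herm_map \<alpha> \<beta> \<gamma> \<in> (SE6_carrier :: ('a::{field,finite} herm \<Rightarrow> _) set)"
  shows "herm_map \<alpha> \<beta> \<gamma> \<in> SE6_abc"
  using assms herm_map_SE6_D(1-3)[OF assms, THEN oct_linear_zero]
  by (simp add: stabilizer_def herm_map_def herm_frame_defs)

abbreviation SE6_abcB :: "('a::{field,finite} herm \<Rightarrow> 'a herm) set" where
  "SE6_abcB \<equiv> stabilizer SE6_abc (herm 0 0 0 0 oct_one 0)"
abbreviation SE6_abcBC :: "('a::{field,finite} herm \<Rightarrow> 'a herm) set" where
  "SE6_abcBC \<equiv> stabilizer SE6_abcB (herm 0 0 0 0 0 oct_one)"

lemma card_SE6_abc: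
  "card (SE6_abc :: ('a::{field,finite} herm \<Rightarrow> _) set)
    = card {x :: 'a oct. oct_norm x = 1} * card (SE6_abcB :: ('a herm \<Rightarrow> _) set)"
proof -
  let ?S = "(\<lambda>x :: 'a oct. herm 0 0 0 0 x 0) ` {x. oct_norm x = 1}"
  have "card (SE6_abc :: ('a herm \<Rightarrow> _) set) = card ?S * card (SE6_abcB :: ('a herm \<Rightarrow> _) set)"
  proof (rule card_orbit_stabilizer)
    show "perm_group (SE6_abc :: ('a herm \<Rightarrow> _) set)" by (rule perm_group_frame)
    fix f :: "'a herm \<Rightarrow> _" assume f: "f \<in> SE6_abc"
    then obtain \<alpha> \<beta> \<gamma> where fm: "f = herm_map \<alpha> \<beta> \<gamma>" using SE6_abc_herm_map by blast
    with f have "herm_map \<alpha> \<beta> \<gamma> \<in> SE6_carrier" by (simp add: stabilizer_def)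
    note D = herm_map_SE6_D[OF this]
    show "f (herm 0 0 0 0 oct_one 0) \<in> ?S"
      using D(5) by (auto simp: fm herm_map_def D(1,3)[THEN oct_linear_zero])
  next
    fix y assume "y \<in> ?S"
    then obtain x where x: "oct_norm x = 1" "y = herm 0 0 0 0 x 0" by blast
    \<comment> \<open>On B this is left multiplication by the inverse of x.\<close>
    let ?f = "herm_map (\<lambda>z. (x \<odot> z) \<odot> x) (\<lambda>z. oct_cnj x \<odot> z) (\<lambda>z. z \<odot> oct_cnj x)"
    have "?f y = herm 0 0 0 0 oct_one 0"
      using oct_cnj_mult_cancel(1)[of x oct_one] by (simp add: x herm_map_def oct_mult_one)
    then show "\<exists>f\<in>SE6_abc. f y = herm 0 0 0 0 oct_one 0"
      using herm_map_SE6_abc[OF herm_map_moufang_SE6[OF x(1)]] by blast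
  qed simp
  also have "card ?S = card {x :: 'a oct. oct_norm x = 1}"
    by (rule card_image) (simp add: inj_on_def)
  finally show ?thesis .
qed

text \<open>On the span of \<open>e_0 - e_{-0}\<close>, \<open>e_1\<close>, \<open>e_{-1}\<close>
  the trace vanishes and the norm is xy - s^2. One linear condition remains, and its solutions
  contain a vector of nonzero norm even over the field of two elements.\<close>

lemma exists_anisotropic_orthogonal:
  fixes g :: "'a::field oct"
  shows "\<exists>v. oct_trace v = 0 \<and> oct_trace (v \<odot> g) = 0 \<and> oct_norm v \<noteq> 0"
proof -
  define v :: "'a \<Rightarrow> 'a \<Rightarrow> 'a \<Rightarrow> 'a oct" where "v s x y = oct8 s (- s) x 0 0 y 0 0" for s x y
  have v: "oct_trace (v s x y) = 0" "oct_norm (v s x y) = x * y - s * s"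
    "oct_trace (v s x y \<odot> g) = s * (g $ Pos I0 - g $ Neg I0) - (x * g $ Neg I1 + y * g $ Pos I1)"
      for s x y
    by (simp_all add: v_def oct_simps algebra_simps)
  show ?thesis
  proof (cases "g $ Pos I0 = g $ Neg I0")
    case True
    then show ?thesis by (intro exI[of _ "v 1 0 0"]) (simp add: v)
  next
    case False
    then have d: "g $ Pos I0 - g $ Neg I0 \<noteq> 0" by simp
    \<comment> \<open>Division turns the condition into s = xk + ym. The solutions with (x, y) = (1,
      0) and (0, 1) have norms -k^2 and -m^2; if both vanish, (1, 1) has norm 1.\<close>
    define k m where "k = g $ Neg I1 / (g $ Pos I0 - g $ Neg I0)" and "m = g $ Pos I1 / (g $ Pos
      I0 - g $ Neg I0)"
    have e: "g $ Neg I1 = k * (g $ Pos I0 - g $ Neg I0)" "g $ Pos I1 = m * (g $ Pos I0 - g $ Neg I0)"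
      using d by (simp_all add: k_def m_def)
    consider "k \<noteq> 0" | "m \<noteq> 0" | "k = 0" "m = 0" by blast
    then show ?thesis
    proof cases
      case 1 then show ?thesis by (intro exI[of _ "v k 1 0"]) (simp add: v e)
    next
      case 2 then show ?thesis by (intro exI[of _ "v m 0 1"]) (simp add: v e)
    next
      case 3 then show ?thesis by (intro exI[of _ "v 0 1 1"]) (simp add: v e)
    qed
  qed
qed

lemma card_SE6_abcB:
  "card (SE6_abcB :: ('a::{field,finite} herm \<Rightarrow> _) set)
    = card {x :: 'a oct. oct_norm x = 1} * card (SE6_abcBC :: ('a herm \<Rightarrow> _) set)"
proof -
  let ?S = "(\<lambda>x :: 'a oct. herm 0 0 0 0 0 x) ` {x. oct_norm x = 1}"
  have "card (SE6_abcB :: ('a herm \<Rightarrow> _) set) = card ?S * card (SE6_abcBC :: ('a herm \<Rightarrow> _) set)"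
  proof (rule card_orbit_stabilizer)
    show "perm_group (SE6_abcB :: ('a herm \<Rightarrow> _) set)" by (intro perm_group_stabilizer perm_group_SE6)
    fix f :: "'a herm \<Rightarrow> _" assume f: "f \<in> SE6_abcB"
    then have f': "f \<in> SE6_abc" by (simp add: stabilizer_def)
    then obtain \<alpha> \<beta> \<gamma> where fm: "f = herm_map \<alpha> \<beta> \<gamma>" using SE6_abc_herm_map by blast
    with f have "herm_map \<alpha> \<beta> \<gamma> \<in> SE6_carrier" by (simp add: stabilizer_def)
    note D = herm_map_SE6_D[OF this]
    show "f (herm 0 0 0 0 0 oct_one) \<in> ?S"
      using D(6) by (auto simp: fm herm_map_def D(1,2)[THEN oct_linear_zero])
  next
    fix y assume "y \<in> ?S"
    then obtain g where g: "oct_norm g = 1" "y = herm 0 0 0 0 0 g" by blast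
    obtain v where v: "oct_trace v = 0" "oct_trace (v \<odot> g) = 0" "oct_norm v \<noteq> 0"
      using exists_anisotropic_orthogonal by blast
    \<comment> \<open>The element w has trace 0 and norm N(v), so its square is -N(v). The multiple
      u of w therefore satisfies u(vg) = 1 and N(u) N(v) = 1.\<close>
    define w where "w = v \<odot> g"
    define u where "u = (- (1 / oct_norm v)) *s w"
    have w: "w \<odot> w = - (oct_norm v *s oct_one)"
    proof -
      have "oct_cnj w = - w" using v(2) by (simp add: w_def oct_cnj_eq)
      then show ?thesis using oct_mult_cnj[of w] g(1)
        by (simp add: w_def oct_mult_minus oct_norm_mult) (metis minus_minus)
    qed
    have u: "oct_trace u = 0" "oct_norm u * oct_norm v = 1"
      using v g(1) by (simp_all add: u_def w_def oct_trace_linear oct_norm_scale oct_norm_mult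
        power2_eq_square)
    let ?f = "herm_map (\<lambda>x. (x \<odot> oct_cnj v) \<odot> oct_cnj u) (\<lambda>x. (u \<odot> ((v \<odot> x) \<odot> oct_cnj v)) \<odot> oct_cnj u)
      (\<lambda>x. u \<odot> (v \<odot> x))"
    have f: "?f \<in> SE6_abc" by (rule herm_map_SE6_abc[OF herm_map_spin_SE6]) (use u v in auto)
    \<comment> \<open>B = 1 is fixed: the conjugations by v and u multiply it by N(v) and by
      N(u).\<close>
    have "(u \<odot> ((v \<odot> oct_one) \<odot> oct_cnj v)) \<odot> oct_cnj u = oct_one"
      using u(2) by (simp add: oct_mult_one oct_mult_cnj oct_mult_scale vector_smult_assoc mult.commute)
    then have "?f \<in> SE6_abcB" using f by (simp add: stabilizer_def[of SE6_abc]) (simp add: herm_map_def)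
    moreover have "u \<odot> (v \<odot> g) = oct_one"
      using w v(3) by (simp add: u_def flip: w_def) (simp add: oct_mult_scale oct_mult_minus vec_eq_iff)
    then have "?f y = herm 0 0 0 0 0 oct_one" by (simp add: g(2) herm_map_def)
    ultimately show "\<exists>f\<in>SE6_abcB. f y = herm 0 0 0 0 0 oct_one" by blast
  qed simp
  also have "card ?S = card {x :: 'a oct. oct_norm x = 1}"
    by (rule card_image) (simp add: inj_on_def)
  finally show ?thesis .
qed

lemma oct_norm_preserving_bil:
  assumes "oct_linear f" "\<And>x. oct_norm (f x) = oct_norm x"
  shows "oct_bil (f x) (f y) = oct_bil x y"
  using oct_norm_add[of x y] oct_norm_add[of "f x" "f y"] assms(1) assms(2)[of "x + y"]
  by (simp add: oct_linear_def assms(2))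

text \<open>First \<alpha> preserves traces, i.e. pairings with 1, and so fixes 1. Putting 1 into
  one argument of the trace form then identifies the three maps, and the full form yields
  multiplicativity.\<close>

lemma SE6_abcBC_automorphism:
  assumes f: "herm_map \<alpha> \<beta> \<gamma> \<in> (SE6_carrier :: ('a::{field,finite} herm \<Rightarrow> _) set)"
    and one: "\<beta> oct_one = oct_one" "\<gamma> oct_one = oct_one"
  shows "\<alpha> = \<gamma>" "\<beta> = \<gamma>" "oct_automorphism \<gamma>"
proof -
  note D = herm_map_SE6_D[OF f]
  note bil = oct_norm_preserving_bil[OF D(1,4)] oct_norm_preserving_bil[OF D(3,6)]
  have tr\<alpha>: "oct_trace (\<alpha> x) = oct_trace x" for x
    using D(7)[of x oct_one oct_one] by (simp add: one oct_mult_one)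
  have bil_eqI: "x = y" if "\<And>z. oct_bil x (\<delta> z) = oct_bil y (\<delta> z)" "surj \<delta>"
    for x y and \<delta> :: "'a oct \<Rightarrow> 'a oct"
    by (rule oct_bil_eqI) (metis that surjD)
  have one\<alpha>: "\<alpha> oct_one = oct_one"
    by (rule bil_eqI[OF _ D(8)]) (simp add: bil oct_bil_one tr\<alpha>)
  have tr: "oct_trace (\<gamma> x) = oct_trace x" for x
    using D(7)[of oct_one oct_one x] by (simp add: one one\<alpha> oct_mult_one)
  have cnj: "\<gamma> (oct_cnj x) = oct_cnj (\<gamma> x)" for x
  proof -
    have "\<gamma> (oct_trace x *s oct_one + (- 1) *s x) = oct_trace x *s oct_one + (- 1) *s \<gamma> x"
      using D(3) one(2) unfolding oct_linear_def by metis
    then show ?thesis by (simp add: oct_cnj_eq tr)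
  qed
  \<comment> \<open>Since \<gamma> is a surjective isometry that commutes with conjugation, traces
    against its values determine an octonion.\<close>
  have eqI: "x = \<gamma> y" if "\<And>z. oct_trace (x \<odot> \<gamma> z) = oct_trace (y \<odot> z)" for x y
    using that[of "oct_cnj _"]
    by (intro bil_eqI[OF _ D(10)]) (simp add: bil oct_trace_mult flip: cnj)
  show \<alpha>: "\<alpha> = \<gamma>"
    by (rule ext, rule eqI) (use D(7)[of _ oct_one] in \<open>simp add: one oct_mult_one\<close>)
  show \<beta>: "\<beta> = \<gamma>"
    by (rule ext, rule eqI) (use D(7)[of oct_one] in \<open>simp add: one\<alpha> oct_mult_one\<close>)
  have "\<gamma> y \<odot> \<gamma> z = \<gamma> (y \<odot> z)" for y z
    by (rule eqI) (use D(7)[unfolded \<alpha> \<beta>] in \<open>metis oct_trace_commute\<close>)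
  then show "oct_automorphism \<gamma>"
    using D(3,6) tr by (simp add: oct_automorphism_def)
qed

lemma oct_automorphism_inj:
  assumes "oct_automorphism g" shows "inj g"
proof (rule injI)
  fix x y assume "g x = g y"
  then have "oct_bil x z = oct_bil y z" for z
    using oct_norm_preserving_bil[of g x z] oct_norm_preserving_bil[of g y z] assms
    by (simp add: oct_automorphism_def)
  then show "x = y" by (rule oct_bil_eqI)
qed

lemma oct_automorphism_one:
  assumes "oct_automorphism (g :: 'a::{field,finite} oct \<Rightarrow> _)" shows "g oct_one = oct_one"
proof -
  have "surj g" using assms by (simp add: oct_automorphism_inj finite_UNIV_inj_surj)
  then obtain e where e: "g e = oct_one" by (metis surjD)
  have m: "g (x \<odot> y) = g x \<odot> g y" for x y using assms by (simp add: oct_automorphism_def)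
  have "g oct_one = g oct_one \<odot> g e" by (simp add: e oct_mult_one)
  also have "\<dots> = oct_one" by (metis m oct_mult_one(2) e)
  finally show ?thesis .
qed

text \<open>Membership in the group is built in because the form must be preserved as a polynomial,
  while \<open>oct_automorphism g\<close> speaks only about octonions over the field.\<close>

definition oct_aut :: "('a::field oct \<Rightarrow> 'a oct) set" where
  "oct_aut = {g. oct_automorphism g \<and> herm_map g g g \<in> SE6_carrier}"

lemma card_SE6_abcBC:
  "card (SE6_abcBC :: ('a::{field,finite} herm \<Rightarrow> _) set) = card (oct_aut :: ('a oct \<Rightarrow> _) set)"
proof -
  have "bij_betw (\<lambda>g. herm_map g g g) (oct_aut :: ('a oct \<Rightarrow> _) set) SE6_abcBC"
  proof (rule bij_betw_imageI)
    have "g = h" if "herm_map g g g = herm_map h h h" for g h :: "'a oct \<Rightarrow> 'a oct"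
    proof
      fix x show "g x = h x"
        using fun_cong[OF that, of "herm 0 0 0 x 0 0"] by (simp add: herm_map_def)
    qed
    then show "inj_on (\<lambda>g. herm_map g g g) (oct_aut :: ('a oct \<Rightarrow> _) set)" by (blast intro: inj_onI)
    show "(\<lambda>g. herm_map g g g) ` oct_aut = (SE6_abcBC :: ('a herm \<Rightarrow> _) set)"
    proof (intro equalityI subsetI)
      fix f :: "'a herm \<Rightarrow> _" assume "f \<in> (\<lambda>g. herm_map g g g) ` oct_aut"
      then obtain g where g: "f = herm_map g g g" "oct_automorphism g" "herm_map g g g \<in> SE6_carrier"
        by (auto simp: oct_aut_def)
      have "g oct_one = oct_one" "g 0 = 0"
        using g(2) oct_automorphism_one oct_linear_zero by (auto simp: oct_automorphism_def)
      then have "f (herm 0 0 0 0 oct_one 0) = herm 0 0 0 0 oct_one 0" "f (herm 0 0 0 0 0 oct_one)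
        = herm 0 0 0 0 0 oct_one"
        by (simp_all add: g(1) herm_map_def)
      with herm_map_SE6_abc[OF g(3)] show "f \<in> SE6_abcBC"
        by (simp add: stabilizer_def flip: g(1))
    next
      fix f :: "'a herm \<Rightarrow> _" assume f: "f \<in> SE6_abcBC"
      then have f': "f \<in> SE6_abc" "f \<in> SE6_carrier" by (simp_all add: stabilizer_def)
      then obtain \<alpha> \<beta> \<gamma> where fm: "f = herm_map \<alpha> \<beta> \<gamma>" using SE6_abc_herm_map by blast
      have one: "\<beta> oct_one = oct_one" "\<gamma> oct_one = oct_one"
        using f by (simp_all add: stabilizer_def fm herm_map_def)
      note A = SE6_abcBC_automorphism[OF f'(2)[unfolded fm] one]
      have "f = herm_map \<gamma> \<gamma> \<gamma>" by (simp add: fm A(1,2))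
      moreover have "\<gamma> \<in> oct_aut" using A(3) f'(2) calculation by (simp add: oct_aut_def)
      ultimately show "f \<in> (\<lambda>g. herm_map g g g) ` oct_aut" by blast
    qed
  qed
  then show ?thesis by (rule bij_betw_same_card[symmetric])
qed

section \<open>Automorphisms of the split octonions\<close>

lemma oct_aut_D:
  assumes "g \<in> oct_aut"
  shows "g (x + y) = g x + g y" "g (c *s x) = c *s g x" "g (x \<odot> y) = g x \<odot> g y"
    "oct_norm (g x) = oct_norm x" "oct_trace (g x) = oct_trace x"
  using assms by (simp_all add: oct_aut_def oct_automorphism_def oct_linear_def)

lemma oct_aut_comp:
  assumes "f \<in> oct_aut" "g \<in> oct_aut" shows "f \<circ> g \<in> oct_aut"
proof -
  have "herm_map (f \<circ> g) (f \<circ> g) (f \<circ> g) = herm_map f f f \<circ> herm_map g g g"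
    by (simp add: fun_eq_iff herm_map_def)
  then show ?thesis
    using assms by (simp add: oct_aut_def SE6_comp) (simp add: oct_automorphism_def oct_linear_def)
qed

lemma perm_group_oct_aut: "perm_group (oct_aut :: ('a::{field,finite} oct \<Rightarrow> _) set)"
proof -
  have "herm_map id id id = (id :: 'a herm \<Rightarrow> _)" by (simp add: fun_eq_iff herm_map_def herm_eta)
  then have "(id :: 'a oct \<Rightarrow> _) \<in> oct_aut"
    by (simp add: oct_aut_def SE6_id oct_automorphism_def oct_linear_def)
  moreover have "bij g" if "g \<in> oct_aut" for g :: "'a oct \<Rightarrow> _"
    using that by (simp add: oct_aut_def oct_automorphism_inj bij_def finite_UNIV_inj_surj)
  ultimately show ?thesis
    by (simp add: perm_group_def oct_aut_comp)
qed

lemma oct_aut_generators: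
  "oct_exp p1 p2 p3 \<in> oct_aut" "oct_trans12 t \<in> oct_aut" "oct_trans21 t \<in> oct_aut"
  "oct_neg \<in> oct_aut" "oct_rot \<in> oct_aut"
  by (simp_all add: oct_aut_def oct_automorphism_exp oct_automorphism_trans oct_automorphism_perm
    herm_map_oct_auto_SE6)

abbreviation oct_pos :: "'a \<Rightarrow> 'a \<Rightarrow> 'a \<Rightarrow> 'a::zero oct" where
  "oct_pos p1 p2 p3 \<equiv> oct8 0 0 p1 p2 p3 0 0 0"
abbreviation oct_e0 :: "'a::zero_neq_one oct" where "oct_e0 \<equiv> oct8 1 0 0 0 0 0 0 0"

abbreviation oct_aut0 :: "('a::{field,finite} oct \<Rightarrow> 'a oct) set" where
  "oct_aut0 \<equiv> stabilizer oct_aut oct_e0"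
abbreviation oct_aut1 :: "('a::{field,finite} oct \<Rightarrow> 'a oct) set" where
  "oct_aut1 \<equiv> stabilizer oct_aut0 (oct_pos 1 0 0)"
abbreviation oct_aut2 :: "('a::{field,finite} oct \<Rightarrow> 'a oct) set" where
  "oct_aut2 \<equiv> stabilizer oct_aut1 (oct_pos 0 1 0)"
abbreviation oct_aut3 :: "('a::{field,finite} oct \<Rightarrow> 'a oct) set" where
  "oct_aut3 \<equiv> stabilizer oct_aut2 (oct_pos 0 0 1)"

lemma oct8_cases: obtains a d p1 p2 p3 n1 n2 n3 where "x = oct8 a d p1 p2 p3 n1 n2 n3"
proof
  show "x = oct8 (x $ Pos I0) (x $ Neg I0) (x $ Pos I1) (x $ Pos I\<omega>) (x $ Pos I\<omega>bar) (x $ Neg I1)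
    (x $ Neg I\<omega>) (x $ Neg I\<omega>bar)"
    by (simp add: vec_eq_iff all_pmidx)
qed

lemma oct8_eq_iff [simp]: "oct8 a d p1 p2 p3 n1 n2 n3 = oct8 a' d' p1' p2' p3' n1' n2' n3' \<longleftrightarrow>
    a = a' \<and> d = d' \<and> p1 = p1' \<and> p2 = p2' \<and> p3 = p3' \<and> n1 = n1' \<and> n2 = n2' \<and> n3 = n3'"
  by (auto simp: vec_eq_iff all_pmidx)

lemma oct8_norm_trace: "oct_trace (oct8 a d p1 p2 p3 n1 n2 n3) = a + d"
  "oct_norm (oct8 a d p1 p2 p3 n1 n2 n3) = a * d + p1 * n1 + p2 * n2 + p3 * n3"
  by (simp_all add: oct_simps add.assoc)

lemma oct_auto_oct8:
  "oct_neg (oct8 a d p1 p2 p3 n1 n2 n3) = oct8 d a n1 n2 n3 p1 p2 p3"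
  "oct_rot (oct8 a d p1 p2 p3 n1 n2 n3) = oct8 a d p3 p1 p2 n3 n1 n2"
  "oct_trans12 t (oct8 a d p1 p2 p3 n1 n2 n3) = oct8 a d (p1 + t * p2) p2 p3 n1 (n2 - t * n1) n3"
  "oct_trans21 t (oct8 a d p1 p2 p3 n1 n2 n3) = oct8 a d p1 (p2 + t * p1) p3 (n1 - t * n2) n2 n3"
  by (simp_all add: oct_auto_defs)

text \<open>Norm 0 means p.n = -ad. For the parameter -p/a the quantities in \<open>oct_exp\<close>
  become s = d and r = a, so the diagonal becomes (1, 0) and p vanishes; n stays, as the cross
  product of p with itself is 0. After negating labels the remaining vector is removed with r =
  -1.\<close>

lemma oct_aut_idempotent:
  fixes x :: "'a::{field,finite} oct"
  assumes "oct_trace x = 1" "oct_norm x = 0" "x $ Pos I0 \<noteq> 0"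
  shows "\<exists>f\<in>oct_aut. f x = oct_e0"
proof (cases x rule: oct8_cases)
  case (1 a d p1 p2 p3 n1 n2 n3)
  have a: "a \<noteq> 0" and d: "d = 1 - a" and n: "p1 * n1 + p2 * n2 + p3 * n3 = - (a * d)"
    using assms by (simp_all add: 1 oct8_norm_trace algebra_simps eq_neg_iff_add_eq_0)
  have s: "(- p1 / a) * n1 + (- p2 / a) * n2 + (- p3 / a) * n3 = d"
  proof -
    have "(- p1 / a) * n1 + (- p2 / a) * n2 + (- p3 / a) * n3 = - (p1 * n1 + p2 * n2 + p3 * n3) / a"
      by (simp add: add_divide_distrib diff_divide_distrib)
    then show ?thesis using a by (simp add: n)
  qed
  define y where "y = oct_exp (- p1 / a) (- p2 / a) (- p3 / a) x"
  have y: "y = oct8 1 0 0 0 0 n1 n2 n3"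
    using a unfolding y_def 1 oct_exp_def oct8_nth s by (simp add: Let_def d field_simps)
  have "oct_neg (oct_exp n1 n2 n3 (oct_neg y)) = oct_e0"
    by (simp add: y oct_auto_oct8 oct_exp_def)
  then have "(oct_neg \<circ> oct_exp n1 n2 n3 \<circ> oct_neg \<circ> oct_exp (- p1 / a) (- p2 / a) (- p3 / a)) x =
    oct_e0"
    by (simp add: y_def)
  then show ?thesis by (meson oct_aut_comp oct_aut_generators)
qed

lemma oct_aut_transitive:
  fixes x :: "'a::{field,finite} oct"
  assumes x: "oct_trace x = 1" "oct_norm x = 0"
  shows "\<exists>f\<in>oct_aut. f x = oct_e0"
proof (cases "x $ Pos I0 = 0")
  case False
  then show ?thesis using oct_aut_idempotent x by blast
next
  case True
  then have "oct_neg x $ Pos I0 \<noteq> 0" using x(1) by (simp add: oct_neg_def oct_trace_def)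
  then have "\<exists>f\<in>oct_aut. f (oct_neg x) = oct_e0"
    using x by (intro oct_aut_idempotent) (simp_all add: oct_aut_D oct_aut_generators)
  then show ?thesis by (rule perm_group_reach[OF perm_group_oct_aut oct_aut_generators(4)])
qed

text \<open>Conjugating two of them by the rotation of order 3 produces all six elementary
  transvections of the positive span.\<close>

lemma oct_transvections:
  fixes t :: "'a::{field,finite}"
  defines "H \<equiv> oct_aut0"
  shows "\<exists>f\<in>H. \<forall>p1 p2 p3. f (oct_pos p1 p2 p3) = oct_pos (p1 + t * p2) p2 p3"
    "\<exists>f\<in>H. \<forall>p1 p2 p3. f (oct_pos p1 p2 p3) = oct_pos (p1 + t * p3) p2 p3"
    "\<exists>f\<in>H. \<forall>p1 p2 p3. f (oct_pos p1 p2 p3) = oct_pos p1 (p2 + t * p1) p3"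
    "\<exists>f\<in>H. \<forall>p1 p2 p3. f (oct_pos p1 p2 p3) = oct_pos p1 (p2 + t * p3) p3"
    "\<exists>f\<in>H. \<forall>p1 p2 p3. f (oct_pos p1 p2 p3) = oct_pos p1 p2 (p3 + t * p1)"
    "\<exists>f\<in>H. \<forall>p1 p2 p3. f (oct_pos p1 p2 p3) = oct_pos p1 p2 (p3 + t * p2)"
proof -
  have mem: "f \<in> H" if "f \<in> oct_aut" "f oct_e0 = oct_e0" for f
    using that by (simp add: H_def stabilizer_def)
  note c = oct_aut_comp oct_aut_generators(2,3,5)
  show "\<exists>f\<in>H. \<forall>p1 p2 p3. f (oct_pos p1 p2 p3) = oct_pos (p1 + t * p2) p2 p3"
    by (rule bexI[of _ "oct_trans12 t"]) (auto intro!: mem c simp: oct_auto_oct8)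
  show "\<exists>f\<in>H. \<forall>p1 p2 p3. f (oct_pos p1 p2 p3) = oct_pos (p1 + t * p3) p2 p3"
    by (rule bexI[of _ "oct_rot \<circ> oct_rot \<circ> oct_trans21 t \<circ> oct_rot"]) (auto intro!: mem c simp:
      oct_auto_oct8)
  show "\<exists>f\<in>H. \<forall>p1 p2 p3. f (oct_pos p1 p2 p3) = oct_pos p1 (p2 + t * p1) p3"
    by (rule bexI[of _ "oct_trans21 t"]) (auto intro!: mem c simp: oct_auto_oct8)
  show "\<exists>f\<in>H. \<forall>p1 p2 p3. f (oct_pos p1 p2 p3) = oct_pos p1 (p2 + t * p3) p3"
    by (rule bexI[of _ "oct_rot \<circ> oct_trans12 t \<circ> oct_rot \<circ> oct_rot"]) (auto intro!: mem c simp: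
      oct_auto_oct8)
  show "\<exists>f\<in>H. \<forall>p1 p2 p3. f (oct_pos p1 p2 p3) = oct_pos p1 p2 (p3 + t * p1)"
    by (rule bexI[of _ "oct_rot \<circ> oct_rot \<circ> oct_trans12 t \<circ> oct_rot"]) (auto intro!: mem c simp:
      oct_auto_oct8)
  show "\<exists>f\<in>H. \<forall>p1 p2 p3. f (oct_pos p1 p2 p3) = oct_pos p1 p2 (p3 + t * p2)"
    by (rule bexI[of _ "oct_rot \<circ> oct_trans21 t \<circ> oct_rot \<circ> oct_rot"]) (auto intro!: mem c simp:
      oct_auto_oct8)
qed

lemma perm_group_oct_aut_stab:
  "perm_group (oct_aut0 :: ('a::{field,finite} oct \<Rightarrow> _) set)"
  "perm_group (oct_aut1 :: ('a::{field,finite} oct \<Rightarrow> _) set)"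
  "perm_group (oct_aut2 :: ('a::{field,finite} oct \<Rightarrow> _) set)"
  by (intro perm_group_stabilizer perm_group_oct_aut)+

lemma oct_aut0_transitive:
  fixes p1 p2 p3 :: "'a::{field,finite}"
  assumes "p1 \<noteq> 0 \<or> p2 \<noteq> 0 \<or> p3 \<noteq> 0"
  shows "\<exists>f\<in>oct_aut0. f (oct_pos p1 p2 p3) = oct_pos 1 0 0"
proof -
  note reach = perm_group_reach[OF perm_group_oct_aut_stab(1)]
  have 1: "\<exists>f\<in>oct_aut0. f (oct_pos 1 p2 p3) = oct_pos 1 0 0" for p2 p3 :: 'a
  proof -
    obtain f where f: "f \<in> oct_aut0" "f (oct_pos 1 p2 p3) = oct_pos 1 0 p3"
      using oct_transvections(3)[of "- p2"] by force
    obtain g where g: "g \<in> oct_aut0" "g (oct_pos 1 0 p3) = oct_pos 1 0 0"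
      using oct_transvections(5)[of "- p3"] by force
    show ?thesis using reach[OF f(1)] f(2) g by metis
  qed
  have 2: "\<exists>f\<in>oct_aut0. f (oct_pos p1 p2 p3) = oct_pos 1 0 0" if nz: "p2 \<noteq> 0" for p1 p2 p3 :: 'a
  proof -
    obtain f where f: "f \<in> oct_aut0" "f (oct_pos p1 p2 p3) = oct_pos 1 p2 p3"
      using oct_transvections(1)[of "(1 - p1) / p2"] nz by force
    show ?thesis using reach[OF f(1)] f(2) 1 by metis
  qed
  consider "p2 \<noteq> 0" | "p3 \<noteq> 0" | "p2 = 0" "p1 \<noteq> 0" using assms by blast
  then show ?thesis
  proof cases
    case 1
    then show ?thesis by (rule 2)
  next
    case 2
    obtain f where f: "f \<in> oct_aut0" "f (oct_pos p1 p2 p3) = oct_pos 1 p2 p3"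
      using oct_transvections(2)[of "(1 - p1) / p3"] 2 by force
    show ?thesis using reach[OF f(1)] f(2) 1 by metis
  next
    case 3
    \<comment> \<open>With p2 = 0 the first coordinate is copied to the second place, which leads
      back to the case already solved.\<close>
    obtain f where f: "f \<in> oct_aut0" "f (oct_pos p1 p2 p3) = oct_pos p1 p1 p3"
      using oct_transvections(3)[of 1] 3 by force
    show ?thesis using reach[OF f(1)] f(2) 2[OF 3(2)] by metis
  qed
qed

lemma oct_aut1_transitive:
  fixes p1 p2 p3 :: "'a::{field,finite}"
  assumes "p2 \<noteq> 0 \<or> p3 \<noteq> 0"
  shows "\<exists>f\<in>oct_aut1. f (oct_pos p1 p2 p3) = oct_pos 0 1 0"
proof -
  note reach = perm_group_reach[OF perm_group_oct_aut_stab(2)]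
  have mem: "f \<in> oct_aut1" if "f \<in> oct_aut0" "f (oct_pos 1 0 0) = oct_pos 1 0 0" for f :: "'a oct \<Rightarrow> _"
    using that by (simp add: stabilizer_def)
  have 1: "\<exists>f\<in>oct_aut1. f (oct_pos p1 1 p3) = oct_pos 0 1 0" for p1 p3 :: 'a
  proof -
    obtain f where f: "f \<in> oct_aut1" "f (oct_pos p1 1 p3) = oct_pos 0 1 p3"
      using oct_transvections(1)[of "- p1"] mem by force
    obtain g where g: "g \<in> oct_aut1" "g (oct_pos 0 1 p3) = oct_pos 0 1 0"
      using oct_transvections(6)[of "- p3"] mem by force
    show ?thesis using reach[OF f(1)] f(2) g by metis
  qed
  have 2: "\<exists>f\<in>oct_aut1. f (oct_pos p1 p2 p3) = oct_pos 0 1 0" if nz: "p3 \<noteq> 0" for p1 p2 p3 :: 'a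
  proof -
    obtain f where f: "f \<in> oct_aut1" "f (oct_pos p1 p2 p3) = oct_pos p1 1 p3"
      using oct_transvections(4)[of "(1 - p2) / p3"] nz mem by force
    show ?thesis using reach[OF f(1)] f(2) 1 by metis
  qed
  show ?thesis
  proof (cases "p3 = 0")
    case False
    then show ?thesis by (rule 2)
  next
    case True
    then have p2: "p2 \<noteq> 0" using assms by blast
    obtain f where f: "f \<in> oct_aut1" "f (oct_pos p1 p2 p3) = oct_pos p1 p2 p2"
      using oct_transvections(6)[of 1] True mem by force
    show ?thesis using reach[OF f(1)] f(2) 2[OF p2] by metis
  qed
qed

lemma oct_aut2_transitive:
  fixes p1 p2 :: "'a::{field,finite}"
  shows "\<exists>f\<in>oct_aut2. f (oct_pos p1 p2 1) = oct_pos 0 0 1"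
proof -
  note reach = perm_group_reach[OF perm_group_oct_aut_stab(3)]
  have mem: "f \<in> oct_aut2" if "f \<in> oct_aut0" "f (oct_pos 1 0 0) = oct_pos 1 0 0" "f (oct_pos 0 1
    0) = oct_pos 0 1 0"
    for f :: "'a oct \<Rightarrow> _"
    using that by (simp add: stabilizer_def)
  obtain f where f: "f \<in> oct_aut2" "f (oct_pos p1 p2 1) = oct_pos 0 p2 1"
    using oct_transvections(2)[of "- p1"] mem by force
  obtain g where g: "g \<in> oct_aut2" "g (oct_pos 0 p2 1) = oct_pos 0 0 1"
    using oct_transvections(4)[of "- p2"] mem by force
  show ?thesis using reach[OF f(1)] f(2) g by metis
qed

text \<open>The positive span is a Peirce space of the idempotent \<open>oct_e0\<close>, so every
  automorphism fixing \<open>oct_e0\<close> preserves it.\<close>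

lemma oct_pos_iff: "oct_e0 \<odot> x = 0 \<and> x \<odot> oct_e0 = x \<longleftrightarrow> (\<exists>p1 p2 p3. x = oct_pos p1 p2 p3)"
  by (cases x rule: oct8_cases) (auto simp: oct_simps)

lemma oct_aut0_oct_pos:
  assumes "g \<in> oct_aut0" shows "\<exists>p1' p2' p3'. g (oct_pos p1 p2 p3) = oct_pos p1' p2' p3'"
proof -
  have g: "g \<in> oct_aut" "g oct_e0 = oct_e0" using assms by (auto simp: stabilizer_def)
  have "g 0 = 0" using g(1) by (simp add: oct_aut_def oct_automorphism_def oct_linear_zero)
  then show ?thesis
    using oct_pos_iff[of "oct_pos p1 p2 p3"] oct_pos_iff[of "g (oct_pos p1 p2 p3)"]
      oct_aut_D(3)[OF g(1)] g(2)
    by metis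
qed

text \<open>The fixed vectors generate the algebra: products of two positive basis vectors give the
  negative ones, and \<open>e_{-0}\<close> is the identity minus \<open>oct_e0\<close>.\<close>

lemma oct_aut3_trivial: "oct_aut3 = {id :: 'a::{field,finite} oct \<Rightarrow> _}"
proof (intro equalityI subsetI)
  fix g :: "'a oct \<Rightarrow> 'a oct" assume "g \<in> oct_aut3"
  then have g: "g \<in> oct_aut" and fixed: "g oct_e0 = oct_e0" "g (oct_pos 1 0 0) = oct_pos 1 0 0"
    "g (oct_pos 0 1 0) = oct_pos 0 1 0" "g (oct_pos 0 0 1) = oct_pos 0 0 1"
    by (auto simp: stabilizer_def)
  note D = oct_aut_D[OF g]
  have one: "g oct_one = oct_one" using g oct_automorphism_one by (auto simp: oct_aut_def)
  have n: "oct8 0 0 0 0 0 1 0 0 = oct_pos 0 1 0 \<odot> oct_pos 0 0 1" "oct8 0 0 0 0 0 0 1 0 = oct_pos 0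
    0 1 \<odot> oct_pos 1 0 0"
    "oct8 0 0 0 0 0 0 0 1 = oct_pos 1 0 0 \<odot> oct_pos 0 1 0" for u :: 'a
    by (simp_all add: oct_simps)
  have gn: "g (oct8 0 0 0 0 0 1 0 0) = oct8 0 0 0 0 0 1 0 0" "g (oct8 0 0 0 0 0 0 1 0) = oct8 0 0
    0 0 0 0 1 0"
    "g (oct8 0 0 0 0 0 0 0 1) = oct8 0 0 0 0 0 0 0 1"
    unfolding n D(3) fixed by simp_all
  have "g x = x" for x
  proof (cases x rule: oct8_cases)
    case (1 a d p1 p2 p3 n1 n2 n3)
    have x: "x = (a - d) *s oct_e0 + d *s oct_one + p1 *s oct_pos 1 0 0 + p2 *s oct_pos 0 1 0 + p3
      *s oct_pos 0 0 1
      + n1 *s oct8 0 0 0 0 0 1 0 0 + n2 *s oct8 0 0 0 0 0 0 1 0 + n3 *s oct8 0 0 0 0 0 0 0 1"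
      by (simp add: 1 oct_simps)
    show "g x = x" unfolding x D(1,2) fixed one gn by (rule refl)
  qed
  then show "g \<in> {id}" by auto
next
  fix g :: "'a oct \<Rightarrow> 'a oct" assume "g \<in> {id}"
  then show "g \<in> oct_aut3" using perm_group_oct_aut[where 'a = 'a]
    by (simp add: stabilizer_def perm_group_def)
qed

lemma card_oct_aut:
  "card (oct_aut :: ('a::{field,finite} oct \<Rightarrow> _) set) =
    card {x :: 'a oct. oct_trace x = 1 \<and> oct_norm x = 0} *
    (card {(p1 :: 'a, p2 :: 'a, p3 :: 'a). p1 \<noteq> 0 \<or> p2 \<noteq> 0 \<or> p3 \<noteq> 0} *
    (card {(p1 :: 'a, p2 :: 'a, p3 :: 'a). p2 \<noteq> 0 \<or> p3 \<noteq> 0} *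
     card (UNIV :: ('a \<times> 'a) set)))"
proof -
  let ?f = "\<lambda>(p1, p2, p3). oct_pos p1 p2 p3 :: 'a oct"
  have inj: "inj_on ?f S" for S by (auto simp: inj_on_def)
  have "card (oct_aut :: ('a oct \<Rightarrow> _) set) = card {x :: 'a oct. oct_trace x = 1 \<and> oct_norm x = 0}
    * card (oct_aut0 :: ('a oct \<Rightarrow> _) set)"
    by (rule card_orbit_stabilizer[OF perm_group_oct_aut])
      (simp_all add: oct_aut_transitive oct_aut_D oct8_norm_trace)
  also have "card (oct_aut0 :: ('a oct \<Rightarrow> _) set) =
     card (?f ` {(p1, p2, p3). p1 \<noteq> 0 \<or> p2 \<noteq> 0 \<or> p3 \<noteq> 0}) * card (oct_aut1 :: ('a oct \<Rightarrow> _) set)"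
  proof (rule card_orbit_stabilizer[OF perm_group_oct_aut_stab(1)])
    fix g :: "'a oct \<Rightarrow> 'a oct" assume g: "g \<in> oct_aut0"
    then obtain p1 p2 p3 where p: "g (oct_pos 1 0 0) = oct_pos p1 p2 p3" using oct_aut0_oct_pos by blast
    have "g 0 = 0" "inj g" using g by (simp_all add: stabilizer_def oct_aut_def
      oct_automorphism_def oct_linear_zero oct_automorphism_inj)
    then have "oct_pos p1 p2 p3 \<noteq> 0" using p by (metis injD oct8_nth(3) zero_index zero_neq_one)
    then have "p1 \<noteq> 0 \<or> p2 \<noteq> 0 \<or> p3 \<noteq> 0" by (auto simp: vec_eq_iff all_pmidx)
    then show "g (oct_pos 1 0 0) \<in> ?f ` {(p1, p2, p3). p1 \<noteq> 0 \<or> p2 \<noteq> 0 \<or> p3 \<noteq> 0}" by (force simp: p)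
  qed (auto intro!: oct_aut0_transitive)
  also have "card (oct_aut1 :: ('a oct \<Rightarrow> _) set) =
     card (?f ` {(p1, p2, p3). p2 \<noteq> 0 \<or> p3 \<noteq> 0}) * card (oct_aut2 :: ('a oct \<Rightarrow> _) set)"
  proof (rule card_orbit_stabilizer[OF perm_group_oct_aut_stab(2)])
    fix g :: "'a oct \<Rightarrow> 'a oct" assume g: "g \<in> oct_aut1"
    then have g': "g \<in> oct_aut0" "g \<in> oct_aut" "g (oct_pos 1 0 0) = oct_pos 1 0 0"
      by (simp_all add: stabilizer_def)
    then obtain p1 p2 p3 where p: "g (oct_pos 0 1 0) = oct_pos p1 p2 p3" using oct_aut0_oct_pos by blast
    have "p2 \<noteq> 0 \<or> p3 \<noteq> 0"
    proof (rule ccontr)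
      assume "\<not> (p2 \<noteq> 0 \<or> p3 \<noteq> 0)"
      then have "g (oct_pos 0 1 0) = p1 *s oct_pos 1 0 0" by (simp add: p oct_simps)
      also have "\<dots> = g (p1 *s oct_pos 1 0 0)" using oct_aut_D(2)[OF g'(2)] g'(3) by simp
      finally have "oct_pos 0 1 0 = p1 *s oct_pos 1 0 0"
        using g'(2) oct_automorphism_inj by (metis (mono_tags, lifting) injD mem_Collect_eq oct_aut_def)
      then show False by (simp add: oct_simps)
    qed
    then show "g (oct_pos 0 1 0) \<in> ?f ` {(p1, p2, p3). p2 \<noteq> 0 \<or> p3 \<noteq> 0}" by (force simp: p)
  qed (auto intro!: oct_aut1_transitive)
  also have "card (oct_aut2 :: ('a oct \<Rightarrow> _) set) =
     card (range (\<lambda>(p1, p2). oct_pos p1 p2 1 :: 'a oct)) * card (oct_aut3 :: ('a oct \<Rightarrow> _) set)"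
  proof (rule card_orbit_stabilizer[OF perm_group_oct_aut_stab(3)])
    fix g :: "'a oct \<Rightarrow> 'a oct" assume g: "g \<in> oct_aut2"
    then have g': "g \<in> oct_aut0" "g \<in> oct_aut" "g oct_e0 = oct_e0"
      "g (oct_pos 1 0 0) = oct_pos 1 0 0" "g (oct_pos 0 1 0) = oct_pos 0 1 0"
        by (simp_all add: stabilizer_def)
    then obtain p1 p2 p3 where p: "g (oct_pos 0 0 1) = oct_pos p1 p2 p3" using oct_aut0_oct_pos by blast
    \<comment> \<open>The triple product on the positive span is minus the determinant times
      \<open>oct_e0\<close>. Its invariance forces the last coefficient to be 1 and is what singles
      out SL3 inside GL3.\<close>
    have e: "(oct_pos 1 0 0 \<odot> oct_pos 0 1 0) \<odot> oct_pos r1 r2 r3 = (- r3) *s oct_e0" for r1 r2 r3 :: 'a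
      by (simp add: oct_simps)
    have "g ((oct_pos 1 0 0 \<odot> oct_pos 0 1 0) \<odot> oct_pos 0 0 1) = (oct_pos 1 0 0 \<odot> oct_pos 0 1 0) \<odot>
      oct_pos p1 p2 p3"
      by (simp add: oct_aut_D(3)[OF g'(2)] g'(4,5) p)
    then have "(- 1) *s oct_e0 = (- p3) *s (oct_e0 :: 'a oct)"
      unfolding e oct_aut_D(2)[OF g'(2)] g'(3) .
    then have "p3 = 1" by (simp add: oct_simps)
    then show "g (oct_pos 0 0 1) \<in> range (\<lambda>(p1, p2). oct_pos p1 p2 1)" by (force simp: p)
  qed (auto intro!: oct_aut2_transitive)
  also have "card (range (\<lambda>(p1, p2). oct_pos p1 p2 1 :: 'a oct)) = card (UNIV :: ('a \<times> 'a) set)"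
    by (rule card_image) (auto simp: inj_on_def)
  finally show ?thesis
    by (simp add: card_image[OF inj] oct_aut3_trivial)
qed

section \<open>Counting\<close>

lemma int_card_Diff_singleton: "finite S \<Longrightarrow> x \<in> S \<Longrightarrow> int (card (S - {x})) = int (card S) - 1"
  by (metis card_Suc_Diff1 of_nat_Suc add_diff_cancel_left')

text \<open>Here u is the generic fibre size and w the excess over 0. This shape survives orthogonal
  sums, so hyperbolic planes can be added one at a time.\<close>

lemma card_fibres_add:
  fixes f :: "'x::finite \<Rightarrow> 'a::{field,finite}" and g :: "'y::finite \<Rightarrow> 'a"
  assumes f: "\<And>t. int (card {x. f x = t}) = u + (if t = 0 then w else 0)"
    and g: "\<And>t. int (card {y. g y = t}) = u' + (if t = 0 then w' else 0)"
  shows "int (card {(x, y). f x + g y = t}) =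
    int CARD('a) * u * u' + w * u' + u * w' + (if t = 0 then w * w' else 0)"
proof -
  have "{(x, y). f x + g y = t} = (\<Union>s. {x. f x = s} \<times> {y. g y = t - s})"
    by (auto simp: algebra_simps)
  also have "card \<dots> = (\<Sum>s\<in>UNIV. card ({x. f x = s} \<times> {y. g y = t - s}))"
    by (rule card_UN_disjoint) auto
  finally have "int (card {(x, y). f x + g y = t}) =
      (\<Sum>s\<in>UNIV. (u + (if s = 0 then w else 0)) * (u' + (if t - s = 0 then w' else 0)))"
    by (simp add: card_cartesian_product f g)
  also have "\<dots> = (\<Sum>s\<in>UNIV. u * u' + (if s = 0 then w * u' else 0) + (if s = t then u * w' else 0)
      + (if s = 0 then if t = 0 then w * w' else 0 else 0))"
    by (intro sum.cong) (auto simp: algebra_simps)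
  also have "\<dots> = int CARD('a) * u * u' + w * u' + u * w' + (if t = 0 then w * w' else 0)"
    by (simp add: sum.distrib)
  finally show ?thesis .
qed

lemma card_mult_fibre:
  fixes t :: "'a::{field,finite}"
  shows "int (card {y. (\<lambda>(a, b). a * b) y = t}) = (int CARD('a) - 1) + (if t = 0 then int CARD('a)
    else 0)"
proof -
  have c: "card {b. a * b = t} = (if a = 0 then if t = 0 then CARD('a) else 0 else 1)" for a
  proof (cases "a = 0")
    case False
    then have "{b. a * b = t} = {t / a}" by (auto simp: field_simps)
    then show ?thesis using False by simp
  qed auto
  have "{y. (\<lambda>(a, b). a * b) y = t} = Sigma UNIV (\<lambda>a. {b. a * b = t})" by auto
  then have "card {y. (\<lambda>(a, b). a * b) y = t} = (\<Sum>a\<in>(UNIV :: 'a set). if a = 0 then if t = 0 then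
    CARD('a) else 0 else 1)"
    by (simp add: c)
  also have "\<dots> = (if t = 0 then CARD('a) else 0) + (\<Sum>a\<in>UNIV - {0 :: 'a}. 1)"
    by (subst sum.remove[of _ 0]) (auto intro!: sum.cong)
  also have "(\<Sum>a\<in>UNIV - {0 :: 'a}. 1) = CARD('a) - 1" by simp
  finally show ?thesis by (simp add: of_nat_diff Suc_leI)
qed

context
  fixes q :: int
  assumes q: "q = int CARD('a::{field,finite})"
begin

lemma card_two_products_fibre:
  fixes t :: 'a
  shows "int (card {z. (\<lambda>((a, b), (c, d)). a * b + c * d) z = t}) = (q ^ 3 - q) + (if t = 0 then q
    ^ 2 else 0)"
  using card_fibres_add[OF card_mult_fibre card_mult_fibre, of t]
  by (simp add: q case_prod_unfold algebra_simps power2_eq_square power3_eq_cube)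

lemma card_three_products_fibre:
  fixes t :: 'a
  shows "int (card {z. (\<lambda>((a, b), (c, d), (e, f)). a * b + (c * d + e * f)) z = t})
    = (q ^ 5 - q ^ 2) + (if t = 0 then q ^ 3 else 0)"
  using card_fibres_add[OF card_mult_fibre card_two_products_fibre, of t]
  by (simp add: case_prod_unfold flip: q) (simp add: algebra_simps eval_nat_numeral)

lemma card_oct_norm_fibre: "int (card {x :: 'a oct. oct_norm x = t}) = (q ^ 7 - q ^ 3) + (if t = 0
  then q ^ 4 else 0)"
proof -
  let ?g = "\<lambda>((a :: 'a, b), (c, d), (e, f)). a * b + (c * d + e * f)"
  have "{x :: 'a oct. oct_norm x = t} = (\<lambda>((a :: 'a, d), (p1, n1), (p2, n2), (p3, n3)). oct8 a d
    p1 p2 p3 n1 n2 n3) `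
     {(y, z). (\<lambda>(a, b). a * b) y + ?g z = t}" (is "_ = ?h ` ?S")
  proof (intro equalityI subsetI)
    fix x :: "'a oct" assume x: "x \<in> {x. oct_norm x = t}"
    show "x \<in> ?h ` ?S"
    proof (cases x rule: oct8_cases)
      case (1 a d p1 p2 p3 n1 n2 n3)
      then show ?thesis using x
        by (intro image_eqI[of _ _ "((a, d), (p1, n1), (p2, n2), (p3, n3))"]) (simp_all add:
          oct8_norm_trace add.assoc)
    qed
  qed (auto simp: oct8_norm_trace add.assoc)
  moreover have "inj_on ?h ?S" by (auto simp: inj_on_def)
  ultimately have "card {x :: 'a oct. oct_norm x = t} = card ?S" by (simp add: card_image)
  then show ?thesis
    using card_fibres_add[OF card_mult_fibre card_three_products_fibre, of t]
    by (simp flip: q) (simp add: algebra_simps eval_nat_numeral)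
qed

text \<open>With d = 1 - a the equation is p.n = -a(1 - a). The excess q^3 of the zero fibre occurs
  exactly for a = 0 and a = 1.\<close>

lemma card_oct_idempotents: "int (card {x :: 'a oct. oct_trace x = 1 \<and> oct_norm x = 0}) = q ^ 6 + q ^ 3"
proof -
  let ?g = "\<lambda>((a :: 'a, b), (c, d), (e, f)). a * b + (c * d + e * f)"
  let ?h = "\<lambda>(a :: 'a, (p1, n1), (p2, n2), (p3, n3)). oct8 a (1 - a) p1 p2 p3 n1 n2 n3"
  let ?S = "Sigma UNIV (\<lambda>a. {z. ?g z = - (a * (1 - a))})"
  have "{x :: 'a oct. oct_trace x = 1 \<and> oct_norm x = 0} = ?h ` ?S"
  proof (intro equalityI subsetI)
    fix x :: "'a oct" assume x: "x \<in> {x. oct_trace x = 1 \<and> oct_norm x = 0}"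
    show "x \<in> ?h ` ?S"
    proof (cases x rule: oct8_cases)
      case (1 a d p1 p2 p3 n1 n2 n3)
      then have "d = 1 - a" using x by (simp add: oct8_norm_trace algebra_simps)
      moreover have "a * d + (p1 * n1 + (p2 * n2 + p3 * n3)) = 0"
        using x 1 by (simp add: oct8_norm_trace add.assoc)
      then have "p1 * n1 + (p2 * n2 + p3 * n3) = - (a * d)"
        by (metis add.commute eq_neg_iff_add_eq_0)
      ultimately show ?thesis using 1
        by (intro image_eqI[of _ _ "(a, (p1, n1), (p2, n2), (p3, n3))"]) simp_all
    qed
  qed (auto simp: oct8_norm_trace add.assoc)
  moreover have "inj_on ?h ?S" by (auto simp: inj_on_def)
  ultimately have "card {x :: 'a oct. oct_trace x = 1 \<and> oct_norm x = 0} = card ?S"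
    by (simp add: card_image)
  then have "int (card {x :: 'a oct. oct_trace x = 1 \<and> oct_norm x = 0}) = (\<Sum>a\<in>UNIV. (q ^ 5 - q ^
    2) + (if a * (1 - a :: 'a) = 0 then q ^ 3 else 0))"
    by (simp add: card_three_products_fibre del: mult_eq_0_iff)
  also have "\<dots> = q * (q ^ 5 - q ^ 2) + (\<Sum>a\<in>{a :: 'a. a * (1 - a) = 0}. q ^ 3)"
    by (simp add: sum.distrib q sum.If_cases)
  also have "{a :: 'a. a * (1 - a) = 0} = {0, 1}" by auto
  finally show ?thesis by (simp add: algebra_simps eval_nat_numeral)
qed

lemma card_oct: "int CARD('a oct) = q ^ 8"
proof -
  have "CARD(pmidx) = 8" by (simp add: UNIV_pmidx)
  then show ?thesis by (simp add: q)
qed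

section \<open>Annihilators of null octonions\<close>

lemma exists_dual_null:
  fixes A :: "'a oct"
  assumes A: "A \<noteq> 0" "oct_norm A = 0"
  shows "\<exists>u. oct_norm u = 0 \<and> oct_trace u = 0 \<and> oct_bil A u = 1"
proof (cases A rule: oct8_cases)
  case (1 a d p1 p2 p3 n1 n2 n3)
  have bil: "oct_bil A (oct8 a' d' p1' p2' p3' n1' n2' n3') = a * d' + d * a' + (p1 * n1' + n1 * p1')
     + (p2 * n2' + n2 * p2') + (p3 * n3' + n3 * p3')" for a' d' p1' p2' p3' n1' n2' n3'
    by (simp add: 1 oct_simps algebra_simps)
  note e = oct8_norm_trace bil
  consider "p1 \<noteq> 0" | "p2 \<noteq> 0" | "p3 \<noteq> 0" | "n1 \<noteq> 0" | "n2 \<noteq> 0" | "n3 \<noteq> 0"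
    | "p1 = 0" "p2 = 0" "p3 = 0" "n1 = 0" "n2 = 0" "n3 = 0" by blast
  then show ?thesis
  proof cases
    case 1 then show ?thesis by (intro exI[of _ "oct8 0 0 0 0 0 (1 / p1) 0 0"]) (simp add: e)
  next
    case 2 then show ?thesis by (intro exI[of _ "oct8 0 0 0 0 0 0 (1 / p2) 0"]) (simp add: e)
  next
    case 3 then show ?thesis by (intro exI[of _ "oct8 0 0 0 0 0 0 0 (1 / p3)"]) (simp add: e)
  next
    case 4 then show ?thesis by (intro exI[of _ "oct8 0 0 (1 / n1) 0 0 0 0 0"]) (simp add: e)
  next
    case 5 then show ?thesis by (intro exI[of _ "oct8 0 0 0 (1 / n2) 0 0 0 0"]) (simp add: e)
  next
    case 6 then show ?thesis by (intro exI[of _ "oct8 0 0 0 0 (1 / n3) 0 0 0"]) (simp add: e)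
  next
    case 7
    have "a * d = 0" using A(2) by (simp add: 1 7 oct8_norm_trace)
    moreover have "a \<noteq> 0 \<or> d \<noteq> 0" using A(1) by (auto simp: 1 7 oct_simps)
    ultimately have "d - a \<noteq> 0" by auto
    \<comment> \<open>Trace 0 forces the diagonal (s, -s), the pairing with A fixes s, and the
      off-diagonal entries 1 and s^2 bring the norm back to 0.\<close>
    define s where "s = 1 / (d - a)"
    have "d * s - a * s = 1" using \<open>d - a \<noteq> 0\<close> by (simp add: s_def flip: diff_divide_distrib)
    then show ?thesis by (intro exI[of _ "oct8 s (- s) 1 0 0 (s * s) 0 0"]) (simp add: e 7)
  qed
qed

text \<open>For a null u of trace 0 paired to 1 with A, \<open>oct_cnj_mult_bil\<close> makes the
  algebra the direct sum of the annihilators of A and u. Left multiplications by A + u, of norm 1,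
  and by its conjugate embed each in the other, so both have size q^4.\<close>

lemma card_oct_annihilator:
  fixes A :: "'a oct"
  assumes A: "A \<noteq> 0" "oct_norm A = 0"
  shows "int (card {x. A \<odot> x = 0}) = q ^ 4"
proof -
  obtain u where u: "oct_norm u = 0" "oct_trace u = 0" "oct_bil A u = 1" using exists_dual_null[OF
    A] by blast
  have cu: "oct_cnj u = - u" using u(2) by (simp add: oct_cnj_eq)
  let ?K = "\<lambda>A :: 'a oct. {x. A \<odot> x = 0}"
  define r where "r = A + u"
  have r: "oct_norm r = 1" by (simp add: r_def oct_norm_add A u)
  have split: "oct_cnj A \<odot> (u \<odot> x) + oct_cnj u \<odot> (A \<odot> x) = x" for x
    using oct_cnj_mult_bil[of A u x] by (simp add: u)
  have uu: "u \<odot> (oct_cnj u \<odot> x) = 0" "u \<odot> (u \<odot> x) = 0" and AA: "A \<odot> (oct_cnj A \<odot> x) = 0" for x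
    using oct_cnj_mult_cancel(2)[of u x] oct_cnj_mult_cancel(2)[of A x]
      by (simp_all add: u A cu oct_mult_minus)
  have "bij_betw (\<lambda>(x, y). x + y) (?K A \<times> ?K u) UNIV"
  proof (rule bij_betwI[where g = "\<lambda>x. (oct_cnj A \<odot> (u \<odot> x), oct_cnj u \<odot> (A \<odot> x))"])
    fix z assume z: "z \<in> ?K A \<times> ?K u"
    obtain x y where xy: "z = (x, y)" "A \<odot> x = 0" "u \<odot> y = 0" using z by (cases z) auto
    have "oct_cnj A \<odot> (u \<odot> x) = x" "oct_cnj u \<odot> (A \<odot> y) = y"
      using split[of x] split[of y] xy by simp_all
    then show "(oct_cnj A \<odot> (u \<odot> ((\<lambda>(x, y). x + y) z)), oct_cnj u \<odot> (A \<odot> ((\<lambda>(x, y). x + y) z))) = z"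
      by (simp add: xy oct_mult_distrib)
  qed (auto simp: split uu AA)
  then have prod: "card (?K A) * card (?K u) = CARD('a oct)"
    by (simp add: bij_betw_same_card flip: card_cartesian_product)
  have inj: "inj_on ((\<odot>) r) S" "inj_on ((\<odot>) (oct_cnj r)) S" for S
    by (rule inj_onI, metis oct_cnj_mult_cancel(1,2) r vector_smult_lid)+
  have "card (?K A) \<le> card (?K u)"
    by (rule card_inj_on_le[OF inj(1)]) (auto simp: r_def oct_mult_distrib uu)
  moreover have "card (?K u) \<le> card (?K A)"
    by (rule card_inj_on_le[OF inj(2)])
      (auto simp: r_def oct_cnj_linear cu oct_mult_distrib oct_mult_diff oct_mult_minus AA)
  ultimately have "int (card (?K A)) ^ 2 = (q ^ 4) ^ 2"
    using prod card_oct by (simp add: power2_eq_square flip: of_nat_mult power_mult power_add)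
  then show ?thesis by (rule power2_eq_imp_eq) (simp_all add: q)
qed

text \<open>If A is nonzero then AB = 0 gives N(B) A = 0 and hence N(B) = 0, so the annihilator
  count applies; A = 0 leaves all null B.\<close>

lemma card_null_pairs:
  "int (card {(A :: 'a oct, B). oct_norm A = 0 \<and> oct_norm B = 0 \<and> A \<odot> B = 0})
    = (q ^ 7 - q ^ 3 + q ^ 4) + (q ^ 7 - q ^ 3 + q ^ 4 - 1) * q ^ 4"
proof -
  let ?Z = "{A :: 'a oct. oct_norm A = 0}"
  have B: "oct_norm B = 0" if "A \<odot> B = 0" "A \<noteq> 0" for A B :: "'a oct"
  proof -
    have "oct_norm B *s A = 0" using oct_cnj_mult_cancel(3)[of A B] that by simp
    then show ?thesis using that(2) by (auto simp: vec_eq_iff)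
  qed
  have "{(A :: 'a oct, B). oct_norm A = 0 \<and> oct_norm B = 0 \<and> A \<odot> B = 0}
    = Sigma ?Z (\<lambda>A. if A = 0 then ?Z else {B. A \<odot> B = 0})"
    using B by (auto split: if_splits)
  then have "int (card {(A :: 'a oct, B). oct_norm A = 0 \<and> oct_norm B = 0 \<and> A \<odot> B = 0})
    = (\<Sum>A\<in>?Z. int (card (if A = 0 then ?Z else {B. A \<odot> B = 0})))"
    by simp
  also have "\<dots> = int (card ?Z) + (\<Sum>A\<in>?Z - {0}. int (card (if A = 0 then ?Z else {B. A \<odot> B = 0})))"
    by (subst sum.remove[of _ 0]) auto
  also have "(\<Sum>A\<in>?Z - {0}. int (card (if A = 0 then ?Z else {B. A \<odot> B = 0}))) = (\<Sum>A\<in>?Z - {0}. q ^ 4)"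
    by (intro sum.cong) (auto simp: card_oct_annihilator)
  also have "\<dots> = (int (card ?Z) - 1) * q ^ 4"
    by (simp only: sum_constant int_card_Diff_singleton[of ?Z 0] finite mem_Collect_eq oct_bil_simps)
  finally show ?thesis by (simp add: card_oct_norm_fibre)
qed

section \<open>Numbers of white vectors\<close>

lemma card_white_bc: "int (card (white_bc :: 'a herm set)) = q ^ 16"
proof -
  let ?f = "\<lambda>(B :: 'a oct, C). herm 1 (oct_norm C) (oct_norm B) (oct_cnj (B \<odot> C)) B C"
  have w: "white_bc = range ?f"
  proof (intro equalityI subsetI)
    fix x :: "'a herm" assume x: "x \<in> white_bc"
    then have "octB x \<odot> octC x = oct_cnj (octA x)" "x $ Ja = 1" "x $ Jb = oct_norm (octC x)" "x $
      Jc = oct_norm (octB x)"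
      by (auto simp: white_bc_def rank_one_def)
    then have "x = ?f (octB x, octC x)" by (intro herm_eqI) simp_all
    then show "x \<in> range ?f" by blast
  next
    fix x :: "'a herm" assume "x \<in> range ?f"
    then show "x \<in> white_bc"
      by (auto simp: white_bc_def rank_one_def oct_norm_mult oct_cnj_mult oct_cnj_mult_cancel)
  qed
  have "inj ?f" by (auto simp: inj_on_def)
  then have "card (white_bc :: 'a herm set) = CARD('a oct \<times> 'a oct)" unfolding w by (rule card_image)
  then show ?thesis by (simp add: card_oct del: CARD_vec)
qed

text \<open>Agreement in a, b, C is expressed by \<open>det_tri herm_c\<close>, so an element of the
  stabilizer of \<open>herm_c\<close> that takes x0 to \<open>herm_b\<close> carries fibres to
  fibres. Over \<open>herm_b\<close> the fibre is parametrized by A.\<close>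

lemma card_white_c_fibre:
  fixes x0 :: "'a herm"
  assumes x0: "x0 \<in> white_c"
  shows "int (card {x \<in> white_c. x $ Ja = x0 $ Ja \<and> x $ Jb = x0 $ Jb \<and> octC x = octC x0}) = q ^ 8"
proof -
  define P where "P y = {x :: 'a herm. rank_one x \<and> (\<forall>z. det_tri herm_c (x - y) z = 0)}" for y
  have oct_diff: "octC (x - y) = octC x - octC y" for x y :: "'a herm"
    by (simp add: octC_def vec_eq_iff)
  have P: "P y = {x. rank_one x \<and> x $ Ja = y $ Ja \<and> x $ Jb = y $ Jb \<and> octC x = octC y}" for y
    by (auto simp: P_def det_tri_c_zero_iff oct_diff)
  obtain f where f: "f \<in> SE6_c" "f x0 = herm_b" using SE6_c_transitive[OF x0] by blast
  then have f': "f \<in> SE6_carrier" "f herm_c = herm_c" by (auto simp: stabilizer_def)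
  have "bij f" using perm_group_SE6 f'(1) by (auto simp: perm_group_def)
  have "(\<forall>z. det_tri herm_c (f x - herm_b) z = 0) \<longleftrightarrow> (\<forall>z. det_tri herm_c (x - x0) z = 0)" for x
    using SE6_tri_zero_iff[OF f'(1), of herm_c "x - x0"]
      by (simp add: f'(2) SE6_linear(4)[OF f'(1)] f(2))
  then have "P x0 = {x. f x \<in> P herm_b}"
    by (simp add: P_def SE6_rank_one[OF f'(1)])
  then have "bij_betw f (P x0) (P herm_b)"
    using \<open>bij f\<close> by (auto simp: bij_betw_def inj_on_def bij_def surj_def image_iff)
  then have "card (P x0) = card (P herm_b)" by (rule bij_betw_same_card)
  also have "P herm_b = range (\<lambda>A. herm 0 1 (oct_norm A) A 0 0)"
  proof (intro equalityI subsetI)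
    fix x assume x: "x \<in> P herm_b"
    then have "oct_cnj (octB x) = 0" by (auto simp: P rank_one_def herm_b_def)
    then have "octB x = 0" using oct_cnj_eq_iff[of "octB x" 0] by simp
    then have "x = herm 0 1 (oct_norm (octA x)) (octA x) 0 0"
      using x by (intro herm_eqI) (auto simp: P herm_b_def rank_one_def)
    then show "x \<in> range (\<lambda>A. herm 0 1 (oct_norm A) A 0 0)" by blast
  qed (auto simp: P herm_b_def rank_one_def)
  also have "card \<dots> = CARD('a oct)" by (rule card_image) (simp add: inj_on_def)
  also have "P x0 = {x \<in> white_c. x $ Ja = x0 $ Ja \<and> x $ Jb = x0 $ Jb \<and> octC x = octC x0}"
    using x0 by (auto simp: P white_c_def)
  finally show ?thesis by (simp add: card_oct del: CARD_vec)
qed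

text \<open>The projection to (a, b, C) maps onto the nonzero null vectors of the ten-dimensional
  hyperbolic form ab - N(C), with fibres of size q^8.\<close>

lemma card_white_c: "int (card (white_c :: 'a herm set)) = (q ^ 9 + q ^ 5 - q ^ 4 - 1) * q ^ 8"
proof -
  let ?p = "\<lambda>x :: 'a herm. ((x $ Ja, x $ Jb), octC x)"
  let ?T = "{((a, b), C :: 'a oct). (\<lambda>(a, b). a * b) (a, b) + (- oct_norm C) = 0}"
  let ?S = "?T - {((0, 0), 0)}"
  have "card {C :: 'a oct. - oct_norm C = t} = card {C :: 'a oct. oct_norm C = - t}" for t
    by (rule arg_cong[where f = card]) (auto simp: equation_minus_iff)
  then have neg: "int (card {C :: 'a oct. - oct_norm C = t}) = (q ^ 7 - q ^ 3) + (if t = 0 then q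
    ^ 4 else 0)" for t
    by (simp add: card_oct_norm_fibre)
  have T: "int (card ?T) = q ^ 9 + q ^ 5 - q ^ 4"
    using card_fibres_add[OF card_mult_fibre neg, of 0]
    by (simp add: case_prod_unfold flip: q) (simp add: algebra_simps eval_nat_numeral)
  have "((0, 0), 0) \<in> ?T" by simp
  then have S: "int (card ?S) = q ^ 9 + q ^ 5 - q ^ 4 - 1"
    using T by (simp only: int_card_Diff_singleton finite)
  have "?p ` white_c \<subseteq> ?S" by (auto simp: white_c_def rank_one_def)
  then have "card (white_c :: 'a herm set) = (\<Sum>s\<in>?S. card {x \<in> white_c. ?p x = s})"
    using sum.group[of white_c ?S ?p "\<lambda>_. 1::nat"] by simp
  then have "int (card (white_c :: 'a herm set)) = (\<Sum>s\<in>?S. int (card {x \<in> white_c. ?p x = s}))" by simp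
  also have "\<dots> = (\<Sum>s\<in>?S. q ^ 8)"
  proof (intro sum.cong refl)
    fix s assume s: "s \<in> ?S"
    obtain a b C where abc: "s = ((a, b), C)" by (metis surj_pair)
    \<comment> \<open>An explicit point over s shows that no fibre is empty.\<close>
    have "herm a b 0 0 0 C \<in> white_c" using s by (auto simp: abc white_c_def rank_one_def)
    from card_white_c_fibre[OF this] show "int (card {x \<in> white_c. ?p x = s}) = q ^ 8"
      by (simp add: abc conj_assoc)
  qed
  finally show ?thesis using S by simp
qed

text \<open>Outside \<open>white_c\<close> only c, A, B survive: c is free, the rank-one equations
  say that (A, B) is a null pair with product 0, and the zero vector is removed.\<close>

lemma card_white: "int (card (white :: 'a herm set)) = q ^ 17 + q ^ 13 + q ^ 9 - q ^ 8 - q ^ 4 - 1"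
proof -
  let ?f = "\<lambda>(c, A, B). herm 0 0 c A B 0 :: 'a herm"
  let ?P = "{(A :: 'a oct, B). oct_norm A = 0 \<and> oct_norm B = 0 \<and> A \<odot> B = 0}"
  have w: "white = white_c \<union> ?f ` (UNIV \<times> ?P - {(0, 0, 0)})"
  proof (intro equalityI subsetI)
    fix x :: "'a herm" assume x: "x \<in> white"
    show "x \<in> white_c \<union> ?f ` (UNIV \<times> ?P - {(0, 0, 0)})"
    proof (cases "x \<in> white_c")
      case False
      then have 0: "x $ Ja = 0" "x $ Jb = 0" "octC x = 0" using x by (auto simp: white_def white_c_def)
      then have "x = ?f (x $ Jc, octA x, octB x)" by (intro herm_eqI) simp_all
      moreover have "(octA x, octB x) \<in> ?P" using x 0 by (simp add: white_def rank_one_def)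
      moreover have "(x $ Jc, octA x, octB x) \<noteq> (0, 0, 0)"
        using calculation(1) x by (auto simp: white_def herm_zero)
      ultimately show ?thesis by blast
    qed simp
  next
    have "octC 0 = (0 :: 'a oct)" by (simp add: octC_def vec_eq_iff)
    then have "white_c \<subseteq> (white :: 'a herm set)" by (auto simp: white_def white_c_def)
    moreover have "?f y \<in> white" if "y \<in> UNIV \<times> ?P - {(0, 0, 0)}" for y
      using that by (auto simp: white_def rank_one_def simp flip: herm_zero)
    moreover fix x :: "'a herm" assume "x \<in> white_c \<union> ?f ` (UNIV \<times> ?P - {(0, 0, 0)})"
    ultimately show "x \<in> white" by blast
  qed
  have d: "white_c \<inter> ?f ` (UNIV \<times> ?P - {(0, 0, 0)}) = {}" by (auto simp: white_c_def)
  have inj: "inj_on ?f S" for S by (auto simp: inj_on_def)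
  have "card (white :: 'a herm set) = card (white_c :: 'a herm set) + card (UNIV \<times> ?P - {(0 :: 'a,
    0, 0)})"
    unfolding w card_Un_disjoint[OF finite finite d] card_image[OF inj] ..
  moreover have "int (card (UNIV \<times> ?P - {(0 :: 'a, 0, 0)})) = q * int (card ?P) - 1"
    by (subst int_card_Diff_singleton) (simp_all add: card_cartesian_product q)
  ultimately have "int (card (white :: 'a herm set)) = int (card (white_c :: 'a herm set)) + (q *
    int (card ?P) - 1)"
    by simp
  then show ?thesis
    by (simp add: card_white_c card_null_pairs algebra_simps eval_nat_numeral)
qed

lemma card_triples:
  "int (card {(p1 :: 'a, p2 :: 'a, p3 :: 'a). p1 \<noteq> 0 \<or> p2 \<noteq> 0 \<or> p3 \<noteq> 0}) = q ^ 3 - 1"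
  "int (card {(p1 :: 'a, p2 :: 'a, p3 :: 'a). p2 \<noteq> 0 \<or> p3 \<noteq> 0}) = q ^ 3 - q"
proof -
  have "{(p1 :: 'a, p2 :: 'a, p3 :: 'a). p1 \<noteq> 0 \<or> p2 \<noteq> 0 \<or> p3 \<noteq> 0} = UNIV - {(0, 0, 0)}"
    "{(p1 :: 'a, p2 :: 'a, p3 :: 'a). p2 \<noteq> 0 \<or> p3 \<noteq> 0} = UNIV \<times> (UNIV - {(0, 0)})" by auto
  then show "int (card {(p1 :: 'a, p2 :: 'a, p3 :: 'a). p1 \<noteq> 0 \<or> p2 \<noteq> 0 \<or> p3 \<noteq> 0}) = q ^ 3 - 1"
    "int (card {(p1 :: 'a, p2 :: 'a, p3 :: 'a). p2 \<noteq> 0 \<or> p3 \<noteq> 0}) = q ^ 3 - q"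
    by (simp_all only: int_card_Diff_singleton finite UNIV_I card_cartesian_product of_nat_mult)
      (simp_all add: q power3_eq_cube algebra_simps)
qed

end

theorem corollary1:
  fixes q :: nat
  assumes "primepow q"
    and "CARD('a::{field,finite}) = q"
  shows "order (SE6 :: ('a herm \<Rightarrow> 'a herm) monoid) =
    q ^ 36 * (q ^ 12 - 1) * (q ^ 9 - 1) * (q ^ 8 - 1) * (q ^ 6 - 1) * (q ^ 5 - 1) * (q ^ 2 - 1)"
proof -
  let ?Q = "int q"
  note Q = arg_cong[OF assms(2)[symmetric], of int]
  have "q \<ge> 1" using assms(2) by (metis One_nat_def Suc_leI zero_less_card_finite)
  \<comment> \<open>The factors in the goal use truncated subtraction of natural numbers; q >= 1
    makes them agree with integer differences.\<close>
  then have sub: "int (q ^ n - 1) = ?Q ^ n - 1" for n by (simp add: of_nat_diff)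
  have norm_one: "int (card {x :: 'a oct. oct_norm x = 1}) = ?Q ^ 7 - ?Q ^ 3"
    using card_oct_norm_fibre[OF Q, of 1] by simp
  have "int CARD('a \<times> 'a) = ?Q ^ 2" by (simp add: assms(2) power2_eq_square)
  then have "int (order (SE6 :: ('a herm \<Rightarrow> 'a herm) monoid))
    = (?Q ^ 17 + ?Q ^ 13 + ?Q ^ 9 - ?Q ^ 8 - ?Q ^ 4 - 1) * ((?Q ^ 9 + ?Q ^ 5 - ?Q ^ 4 - 1) * ?Q ^
      8 * (?Q ^ 16 *
      ((?Q ^ 7 - ?Q ^ 3) * ((?Q ^ 7 - ?Q ^ 3) * ((?Q ^ 6 + ?Q ^ 3) * ((?Q ^ 3 - 1) * ((?Q ^ 3 -
        ?Q) * ?Q ^ 2)))))))"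
    unfolding order_def card_SE6_frame card_SE6_abc card_SE6_abcB card_SE6_abcBC card_oct_aut of_nat_mult
      card_white[OF Q] card_white_c[OF Q] card_white_bc[OF Q] norm_one card_oct_idempotents[OF Q]
        card_triples[OF Q]
    by simp
  \<comment> \<open>The white count is (q^8 + q^4 + 1)(q^9 - 1). One factor q^4 - 1 from the norm-1
    octonions turns it into (q^12 - 1)(q^9 - 1); the other one meets q^4 + 1. The powers of q add up
    as 8 + 16 + 3 + 3 + 3 + 1 + 2 = 36.\<close>
  also have "\<dots> = ((?Q ^ 17 + ?Q ^ 13 + ?Q ^ 9 - ?Q ^ 8 - ?Q ^ 4 - 1) * (?Q ^ 4 - 1)) *
      ((?Q ^ 4 - 1) * (?Q ^ 4 + 1)) * (?Q ^ 5 - 1) * ((?Q ^ 3 - 1) * (?Q ^ 3 + 1)) * (?Q ^ 2 - 1)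
        * ?Q ^ 36"
  proof -
    have "?Q ^ 9 + ?Q ^ 5 - ?Q ^ 4 - 1 = (?Q ^ 4 + 1) * (?Q ^ 5 - 1)" "?Q ^ 7 - ?Q ^ 3 = ?Q ^ 3 *
      (?Q ^ 4 - 1)"
      "?Q ^ 6 + ?Q ^ 3 = ?Q ^ 3 * (?Q ^ 3 + 1)" "?Q ^ 3 - ?Q = ?Q * (?Q ^ 2 - 1)"
      "?Q ^ 36 = ?Q ^ 8 * ?Q ^ 16 * ?Q ^ 3 * ?Q ^ 3 * ?Q ^ 3 * ?Q * ?Q ^ 2"
      by (simp_all add: algebra_simps eval_nat_numeral)
    then show ?thesis by (simp only: mult_ac)
  qed
  also have "(?Q ^ 17 + ?Q ^ 13 + ?Q ^ 9 - ?Q ^ 8 - ?Q ^ 4 - 1) * (?Q ^ 4 - 1) = (?Q ^ 12 - 1) *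
    (?Q ^ 9 - 1)"
    by (simp add: algebra_simps flip: power_add)
  also have "(?Q ^ 4 - 1) * (?Q ^ 4 + 1) = ?Q ^ 8 - 1"
    by (simp add: algebra_simps flip: power_add)
  also have "(?Q ^ 3 - 1) * (?Q ^ 3 + 1) = ?Q ^ 6 - 1"
    by (simp add: algebra_simps flip: power_add)
  also have "(?Q ^ 12 - 1) * (?Q ^ 9 - 1) * (?Q ^ 8 - 1) * (?Q ^ 5 - 1) * (?Q ^ 6 - 1) * (?Q ^ 2 -
    1) * ?Q ^ 36
    = int (q ^ 36 * (q ^ 12 - 1) * (q ^ 9 - 1) * (q ^ 8 - 1) * (q ^ 6 - 1) * (q ^ 5 - 1) * (q ^ 2 - 1))"
    by (simp only: of_nat_mult sub of_nat_power mult_ac)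
  finally show ?thesis by (simp only: of_nat_eq_iff)
qed


end
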